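(* Let $X$ be a nonempty compact metric space and let $G$ be a countable amenable group acting on $X$ by continuous maps. For an open cover $\mathcal U$ of $X$ define $$h^*_{\mathsf{top}}(G,\mathcal U)=\inf_{F}\frac1{|F|}H_{\mathsf{top}}(\mathcal U^F),$$ where the infimum is over all nonempty finite subsets $F$ of $G$, and define $$h^*_{\mathsf{top}}(G)=\sup_{\mathcal U}h^*_{\mathsf{top}}(G,\mathcal U),$$ where the supremum is over all open covers $\mathcal U$ of $X$. Then $$h^*_{\mathsf{top}}(G)=h_{\mathsf{top}}(G).$$
   Context: For an open cover $\mathcal U$ of $X$ and $f\in G$ put $f^{-1}\mathcal U=\{f^{-1}U:U\in\mathcal U\}$, and for a nonempty finite $F\subset G$ put $\mathcal U^F=\bigvee_{f\in F}f^{-1}\mathcal U$, where the join $\mathcal U\vee\mathcal V=\{U\cap V:U\in\mathcal U,V\in\mathcal V\}$. $N(\mathcal U)$ is the smallest cardinality of a subcover of $\mathcal U$, and $H_{\mathsf{top}}(\mathcal U)=\log N(\mathcal U)$. A F{\o}lner sequence in $G$ is a sequence $(F_n)$ of nonempty finite subsets of $G$ with $\lim_{n\to\infty}\frac{|F_n\triangle gF_n|}{|F_n|}=0$ for every $g\in G$. Fix a F{\o}lner sequence $(F_n)$ in $G$. Topological entropy is defined by $h_{\mathsf{top}}(G,\mathcal U)=\limsup_{n\to\infty}\frac1{|F_n|}H_{\mathsf{top}}(\mathcal U^{F_n})$ and $h_{\mathsf{top}}(G)=\sup_{\mathcal U}h_{\mathsf{top}}(G,\mathcal U)$, the supremum being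 over all open covers $\mathcal U$ of $X$. The values $h_{\mathsf{top}}(G)$ and $h^*_{\mathsf{top}}(G)$ lie in $[0,\infty]$. *)

theory Defs
  imports "HOL-Analysis.Analysis" "HOL-Algebra.Group_Action"
begin

definition open_cover :: "'a topology \<Rightarrow> 'a set set \<Rightarrow> bool" where
  "open_cover T \<U> \<longleftrightarrow> (\<forall>U\<in>\<U>. openin T U) \<and> \<Union>\<U> = topspace T"

definition join :: "'a set set \<Rightarrow> 'a set set \<Rightarrow> 'a set set" where
  "join \<U> \<V> = {U \<inter> V | U V. U \<in> \<U> \<and> V \<in> \<V>}"

text \<open>The join of an indexed family of covers; only meant for nonempty finite index sets,
  where it is the iterated binary join by the two lemmas that follow.\<close>

definition Join :: "'i set \<Rightarrow> ('i \<Rightarrow> 'a set set) \<Rightarrow> 'a set set" where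
  "Join I \<C> = {(\<Inter>i\<in>I. V i) | V. \<forall>i\<in>I. V i \<in> \<C> i}"

lemma Join_singleton: "Join {i} \<C> = \<C> i"
  by (auto simp: Join_def)

lemma Join_insert:
  assumes "i \<notin> I"
  shows "Join (insert i I) \<C> = join (\<C> i) (Join I \<C>)"
proof (intro equalityI subsetI)
  fix W assume "W \<in> Join (insert i I) \<C>"
  then show "W \<in> join (\<C> i) (Join I \<C>)"
    by (auto simp: Join_def join_def)
next
  fix W assume "W \<in> join (\<C> i) (Join I \<C>)"
  then obtain U V where UV: "U \<in> \<C> i" "\<forall>j\<in>I. V j \<in> \<C> j" "W = U \<inter> (\<Inter>j\<in>I. V j)"
    by (auto simp: Join_def join_def)
  have "W = (\<Inter>j\<in>insert i I. (V(i := U)) j)" "\<forall>j\<in>insert i I. (V(i := U)) j \<in> \<C> j"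
    using UV assms by auto
  then show "W \<in> Join (insert i I) \<C>"
    unfolding Join_def by blast
qed

definition pullback_cover :: "'a set \<Rightarrow> ('a \<Rightarrow> 'a) \<Rightarrow> 'a set set \<Rightarrow> 'a set set" where
  "pullback_cover X f \<U> = {f -` U \<inter> X | U. U \<in> \<U>}"

definition dyn_join :: "'a set \<Rightarrow> ('g \<Rightarrow> 'a \<Rightarrow> 'a) \<Rightarrow> 'a set set \<Rightarrow> 'g set \<Rightarrow> 'a set set" where
  "dyn_join X \<phi> \<U> F = Join F (\<lambda>f. pullback_cover X (\<phi> f) \<U>)"

text \<open>Restricted to finite subcovers, since \<open>card\<close> is \<open>0\<close> on infinite sets; in a compact space
  finite subcovers exist.\<close>

definition cover_number :: "'a topology \<Rightarrow> 'a set set \<Rightarrow> nat" where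
  "cover_number T \<U> = (LEAST n. \<exists>\<V>\<subseteq>\<U>. finite \<V> \<and> \<Union>\<V> = topspace T \<and> card \<V> = n)"

definition H_top :: "'a topology \<Rightarrow> 'a set set \<Rightarrow> real" where
  "H_top T \<U> = ln (real (cover_number T \<U>))"

definition folner_sequence :: "('g, 'm) monoid_scheme \<Rightarrow> (nat \<Rightarrow> 'g set) \<Rightarrow> bool" where
  "folner_sequence G F \<longleftrightarrow>
     (\<forall>n. F n \<noteq> {} \<and> finite (F n) \<and> F n \<subseteq> carrier G) \<and>
     (\<forall>g\<in>carrier G. (\<lambda>n. real (card (sym_diff (F n) (g <#\<^bsub>G\<^esub> F n))) / real (card (F n)))
        \<longlonglongrightarrow> 0)"

text \<open>Existence of a sequence, rather than a net, characterizes amenability of countable groups.\<close>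

definition amenable :: "('g, 'm) monoid_scheme \<Rightarrow> bool" where
  "amenable G \<longleftrightarrow> (\<exists>F. folner_sequence G F)"

definition h_top_cover ::
  "'a topology \<Rightarrow> ('g \<Rightarrow> 'a \<Rightarrow> 'a) \<Rightarrow> (nat \<Rightarrow> 'g set) \<Rightarrow> 'a set set \<Rightarrow> ereal" where
  "h_top_cover T \<phi> F \<U> =
     limsup (\<lambda>n. ereal (1 / real (card (F n)) * H_top T (dyn_join (topspace T) \<phi> \<U> (F n))))"

definition h_top :: "'a topology \<Rightarrow> ('g \<Rightarrow> 'a \<Rightarrow> 'a) \<Rightarrow> (nat \<Rightarrow> 'g set) \<Rightarrow> ereal" where
  "h_top T \<phi> F = (SUP \<U>\<in>{\<U>. open_cover T \<U>}. h_top_cover T \<phi> F \<U>)"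

definition h_top_star_cover ::
  "'a topology \<Rightarrow> ('g, 'm) monoid_scheme \<Rightarrow> ('g \<Rightarrow> 'a \<Rightarrow> 'a) \<Rightarrow> 'a set set \<Rightarrow> ereal" where
  "h_top_star_cover T G \<phi> \<U> =
     (INF F\<in>{F. F \<noteq> {} \<and> finite F \<and> F \<subseteq> carrier G}.
        ereal (1 / real (card F) * H_top T (dyn_join (topspace T) \<phi> \<U> F)))"

definition h_top_star ::
  "'a topology \<Rightarrow> ('g, 'm) monoid_scheme \<Rightarrow> ('g \<Rightarrow> 'a \<Rightarrow> 'a) \<Rightarrow> ereal" where
  "h_top_star T G \<phi> = (SUP \<U>\<in>{\<U>. open_cover T \<U>}. h_top_star_cover T G \<phi> \<U>)"

end

theory Submission
  imports Defs
begin

text \<open>Only \<open>h_top \<le> h_top_star\<close> needs work. If \<open>G\<close> is finite, then \<open>F n = G\<close> eventually, and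
  the cover \<open>\<V> = \<U>\<^sup>G\<close> does it because \<open>N(\<V>) \<le> N(\<V>\<^sup>S)\<close> for all \<open>S\<close>.

  For infinite \<open>G\<close> the argument is a finitary form of Misiurewicz's proof of the variational
  principle, with counting in place of measures. Let \<open>K = F n\<close>, let \<open>\<epsilon>\<close> be a Lebesgue number
  of \<open>\<U>\<close>, and let \<open>A\<close> be a maximal \<open>(K, \<epsilon>)\<close>-separated set, so \<open>N(\<U>\<^sup>K) \<le> card A\<close>. Cover the
  space by \<open>p\<close> small balls whose radii are chosen from \<open>m\<close> candidates each. By the pigeonhole
  principle some choice of radii makes the orbits over \<open>K\<close> of many points of \<open>A\<close> visit the thin
  shells around the spheres at most \<open>(p / m) * card K\<close> times. The balls cut the space into a
  partition, and outside the shells this partition agrees with an open cover \<open>\<V>\<close>. Fixing the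
  visits to the shells and the partition elements met there costs a factor
  \<open>exp (o(1) * card K)\<close> as \<open>m\<close> grows. On the points that remain, a word over a translate
  \<open>S g\<close> is determined by an element of \<open>\<V>\<^sup>S\<close>, so Shearer's inequality for words gives
  \<open>N(\<V>\<^sup>S)\<close> to the power \<open>card (S\<inverse> K) / card S\<close> as a bound, and
  \<open>card (S\<inverse> K) / card K\<close> tends to 1. There are only finitely many choices of radii, so a
  set \<open>S\<close> violating the claim can be fixed for each of them before \<open>n\<close> is chosen.\<close>

section \<open>Counting words\<close>

text \<open>Holder's inequality for \<open>card T\<close> factors with equal exponents. After
  division of each factor by its bound \<open>X g\<close>, the arithmetic-geometric mean inequality
  turns the root of the product into an average; summed over \<open>a\<close>, each normalised
  factor contributes at most \<open>1 / m\<close>.\<close>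

lemma holder_product_bound:
  fixes x :: "'g \<Rightarrow> 'a \<Rightarrow> real" and y :: "'a \<Rightarrow> real"
  assumes fin: "finite T" "T \<noteq> {}"
    and x: "\<And>g a. g \<in> T \<Longrightarrow> a \<in> L \<Longrightarrow> 0 \<le> x g a"
    and X: "\<And>g. g \<in> T \<Longrightarrow> 0 < X g" "\<And>g. g \<in> T \<Longrightarrow> (\<Sum>a\<in>L. x g a) \<le> X g"
    and y: "\<And>a. a \<in> L \<Longrightarrow> 0 \<le> y a" "\<And>a. a \<in> L \<Longrightarrow> y a ^ card T \<le> Q * (\<Prod>g\<in>T. x g a)"
    and Q: "0 \<le> Q"
  shows "(\<Sum>a\<in>L. y a) ^ card T \<le> Q * (\<Prod>g\<in>T. X g)"
proof -
  define m where "m = card T"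
  define P where "P = Q * (\<Prod>g\<in>T. X g)"
  have m: "m > 0" using fin by (simp add: m_def card_gt_0_iff)
  have P: "0 \<le> P" unfolding P_def using Q X(1) by (simp add: prod_nonneg less_imp_le)
  have y_le: "y a \<le> P powr (1 / m) * (\<Sum>g\<in>T. x g a / X g / m)" if a: "a \<in> L" for a
  proof -
    have "(\<Prod>g\<in>T. x g a) = (\<Prod>g\<in>T. X g) * (\<Prod>g\<in>T. x g a / X g)"
      unfolding prod.distrib [symmetric] by (intro prod.cong) (use X(1) in force)+
    then have "y a ^ m \<le> P * (\<Prod>g\<in>T. x g a / X g)"
      using y(2)[OF a] by (simp add: m_def P_def mult.assoc)
    then have "(y a ^ m) powr (1 / m) \<le> (P * (\<Prod>g\<in>T. x g a / X g)) powr (1 / m)"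
      using y(1)[OF a] by (intro powr_mono2) auto
    moreover have "(y a ^ m) powr (1 / m) = y a"
      using y(1)[OF a] m by (cases "y a = 0") (simp_all add: powr_realpow [symmetric] powr_powr)
    ultimately have "y a \<le> P powr (1 / m) * (\<Prod>g\<in>T. x g a / X g) powr (1 / m)"
      using P x[OF _ a] X(1) by (simp add: powr_mult prod_nonneg less_imp_le)
    also have "\<dots> \<le> P powr (1 / m) * (\<Sum>g\<in>T. x g a / X g / m)"
      unfolding m_def using arith_geom_mean[OF fin, of "\<lambda>g. x g a / X g"] x[OF _ a] X(1)
      by (intro mult_left_mono) (auto simp: less_imp_le)
    finally show ?thesis .
  qed
  have "(\<Sum>a\<in>L. y a) \<le> (\<Sum>a\<in>L. P powr (1 / m) * (\<Sum>g\<in>T. x g a / X g / m))"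
    by (intro sum_mono y_le)
  also have "\<dots> = P powr (1 / m) * (\<Sum>g\<in>T. (\<Sum>a\<in>L. x g a) / X g / m)"
    unfolding sum_distrib_left [symmetric] sum_divide_distrib by (subst sum.swap) rule
  also have "\<dots> \<le> P powr (1 / m) * (\<Sum>g\<in>T. 1 / m)"
    using X by (intro mult_left_mono sum_mono divide_right_mono) auto
  also have "\<dots> = P powr (1 / m)"
    using m by (simp add: m_def)
  finally have "(\<Sum>a\<in>L. y a) ^ m \<le> (P powr (1 / m)) ^ m"
    using y(1) by (intro power_mono sum_nonneg) auto
  also have "\<dots> = P"
    using P m by (cases "P = 0") (simp_all add: powr_realpow [symmetric] powr_powr)
  finally show ?thesis by (simp add: m_def P_def)
qed

lemma card_image_le_of_factor:
  assumes "finite A" and "\<And>x y. x \<in> A \<Longrightarrow> y \<in> A \<Longrightarrow> r x = r y \<Longrightarrow> p x = p y"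
  shows "card (p ` A) \<le> card (r ` A)"
proof -
  have "p ` A \<subseteq> (p \<circ> inv_into A r) ` (r ` A)"
  proof
    fix z assume "z \<in> p ` A"
    then obtain x where x: "x \<in> A" "z = p x" by blast
    then have "p (inv_into A r (r x)) = z"
      by (metis assms(2) f_inv_into_f imageI inv_into_into)
    then show "z \<in> (p \<circ> inv_into A r) ` (r ` A)"
      using x(1) by (intro image_eqI[of _ _ "r x"]) simp_all
  qed
  then show ?thesis
    using assms(1) by (intro surj_card_le) simp_all
qed

text \<open>Shearer's inequality, by induction on the coordinates. Slice \<open>E\<close> by the
  letter at the new coordinate \<open>h\<close>. Windows containing \<open>h\<close> see that
  letter, so their projections of distinct slices are disjoint and add up; other windows are bounded
  by their projection of \<open>E\<close>. Holder's inequality with exactly \<open>m\<close> factors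
  recombines the slices. Windows may leave \<open>K\<close>, so the induction hypothesis applies to
  the same \<open>S\<close>.\<close>

lemma shearer_card:
  fixes Y :: "'k \<Rightarrow> 'x \<Rightarrow> 'l"
  assumes "finite K" "finite T" "finite E" "0 < m"
    and "\<And>h. h \<in> K \<Longrightarrow> card {g \<in> T. h \<in> S g} = m"
    and "inj_on (\<lambda>x. \<lambda>h\<in>K. Y h x) E"
  shows "card E ^ m \<le> (\<Prod>g\<in>T. card ((\<lambda>x. \<lambda>h\<in>S g. Y h x) ` E))"
  using assms(1,3,5,6)
proof (induction K arbitrary: E rule: finite_induct)
  case empty
  show ?case
  proof (cases "E = {}")
    case False
    \<comment> \<open>Without coordinates all words agree, so injectivity leaves at most one
      point.\<close>
    have "x = y" if "x \<in> E" "y \<in> E" for x y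
      by (rule inj_onD[OF empty.prems(3) _ that]) simp
    with False have "is_singleton E"
      by (auto intro: is_singletonI')
    then have "card E = 1"
      by (simp add: is_singleton_altdef)
    moreover have "1 \<le> (\<Prod>g\<in>T. card ((\<lambda>x. \<lambda>h\<in>S g. Y h x) ` E))"
      using False empty.prems(1) by (intro prod_ge_1) (simp add: Suc_le_eq card_gt_0_iff)
    ultimately show ?thesis
      by (simp only: power_one)
  qed (use \<open>0 < m\<close> in \<open>simp add: power_0_left\<close>)
next
  case (insert h K)
  note finE = \<open>finite E\<close>
  define c where "c g A = card ((\<lambda>x. \<lambda>h\<in>S g. Y h x) ` A)" for g A
  define L where "L = Y h ` E"
  define slice where "slice a = {x \<in> E. Y h x = a}" for a
  define Th where "Th = {g \<in> T. h \<in> S g}"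
  have Th: "finite Th" "Th \<subseteq> T" "card Th = m"
    using \<open>finite T\<close> insert.prems(2)[of h] by (auto simp: Th_def)
  then have "Th \<noteq> {}"
    using \<open>0 < m\<close> by (metis card.empty less_irrefl)
  have slices: "finite L" "E = (\<Union>a\<in>L. slice a)"
    using finE by (auto simp: L_def slice_def)
  show ?case
  proof (cases "E = {}")
    case False
    have c_pos: "0 < c g E" for g
      using False finE by (simp add: c_def card_gt_0_iff)
    have c_sum: "(\<Sum>a\<in>L. c g (slice a)) \<le> c g E" if "g \<in> Th" for g
    proof -
      let ?p = "\<lambda>x. \<lambda>h\<in>S g. Y h x"
      have "h \<in> S g" using that by (simp add: Th_def)
      then have "?p x h = Y h x" for x by simp
      then have "(\<Sum>a\<in>L. card (?p ` slice a)) = card (\<Union>a\<in>L. ?p ` slice a)"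
        using finE by (intro card_UN_disjoint [symmetric] slices(1))
          (auto simp: slice_def dest: fun_cong[where x = h])
      also have "\<dots> = card (?p ` E)"
        by (metis image_UN slices(2))
      finally show ?thesis by (simp add: c_def)
    qed
    have IH: "real (card (slice a)) ^ card Th \<le> real (\<Prod>g\<in>T - Th. c g E) * (\<Prod>g\<in>Th. real (c g (slice a)))"
      for a
    proof -
      have "card (slice a) ^ m \<le> (\<Prod>g\<in>T. card ((\<lambda>x. \<lambda>h\<in>S g. Y h x) ` slice a))"
      proof (rule insert.IH)
        show "finite (slice a)" using finE by (simp add: slice_def)
        \<comment> \<open>The letter at \<open>h\<close> is constant on a slice, so the letters over
          \<open>K\<close> alone still separate its points.\<close>
        show "inj_on (\<lambda>x. \<lambda>h\<in>K. Y h x) (slice a)"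
        proof (rule inj_onI)
          fix x y assume xy: "x \<in> slice a" "y \<in> slice a" "(\<lambda>h\<in>K. Y h x) = (\<lambda>h\<in>K. Y h y)"
          have "Y k x = Y k y" if "k \<in> K" for k
            using fun_cong[OF xy(3), of k] that by simp
          then have "(\<lambda>k\<in>insert h K. Y k x) = (\<lambda>k\<in>insert h K. Y k y)"
            using xy(1,2) by (auto simp: slice_def fun_eq_iff)
          then show "x = y"
            by (rule inj_onD[OF insert.prems(3)]) (use xy(1,2) in \<open>simp_all add: slice_def\<close>)
        qed
      qed (use insert.prems(2) in auto)
      also have "\<dots> = (\<Prod>g\<in>T - Th. c g (slice a)) * (\<Prod>g\<in>Th. c g (slice a))"
        unfolding c_def using \<open>finite T\<close> Th(2) by (simp add: prod.subset_diff)
      also have "\<dots> \<le> (\<Prod>g\<in>T - Th. c g E) * (\<Prod>g\<in>Th. c g (slice a))"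
        unfolding c_def using finE
        by (intro mult_right_mono prod_mono conjI card_mono image_mono) (auto simp: slice_def)
      finally have "card (slice a) ^ card Th \<le> (\<Prod>g\<in>T - Th. c g E) * (\<Prod>g\<in>Th. c g (slice a))"
        by (simp add: Th(3))
      then show ?thesis
        by (metis of_nat_le_iff of_nat_mult of_nat_power of_nat_prod)
    qed
    have "(\<Sum>a\<in>L. real (card (slice a))) ^ card Th
        \<le> real (\<Prod>g\<in>T - Th. c g E) * (\<Prod>g\<in>Th. real (c g E))"
    proof (rule holder_product_bound)
      show "(\<Sum>a\<in>L. real (c g (slice a))) \<le> real (c g E)" if "g \<in> Th" for g
        using c_sum[OF that] by (metis of_nat_le_iff of_nat_sum)
    qed (use Th \<open>Th \<noteq> {}\<close> IH c_pos in \<open>auto intro: prod_nonneg\<close>)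
    also have "\<dots> = real (\<Prod>g\<in>T. c g E)"
      using \<open>finite T\<close> Th(2) by (simp add: prod.subset_diff)
    also have "(\<Sum>a\<in>L. real (card (slice a))) = real (card E)"
    proof -
      have "card (\<Union>a\<in>L. slice a) = (\<Sum>a\<in>L. card (slice a))"
        using slices(1) finE by (intro card_UN_disjoint) (auto simp: slice_def)
      then show ?thesis
        by (metis of_nat_sum slices(2))
    qed
    finally show ?thesis
      unfolding Th(3) c_def by (simp only: of_nat_power [symmetric] of_nat_le_iff)
  qed (use \<open>0 < m\<close> in \<open>simp add: power_0_left\<close>)
qed

text \<open>A Chernoff-type estimate. Put \<open>r = card L / t\<close>, which is at least 1, and
  split \<open>card L ^ card S\<close> as \<open>r ^ card S * t ^ card S\<close>. Sparsity bounds
  the first factor uniformly, and the weights \<open>t ^ card S\<close> over all subsets of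
  \<open>K\<close> sum to \<open>(1 + t) ^ card K\<close>. Choosing \<open>t\<close> small first and
  \<open>\<beta>\<close> small afterwards brings the base close to 1.\<close>

lemma card_sparse_words:
  fixes t \<beta> :: real
  assumes "finite K" "finite L" "L \<noteq> {}" "0 < t" "t \<le> 1"
  shows "real (card (SIGMA S:{S \<in> Pow K. card S \<le> \<beta> * card K}. S \<rightarrow>\<^sub>E L))
    \<le> ((1 + t) * (card L / t) powr \<beta>) ^ card K"
proof -
  define \<S> where "\<S> = {S \<in> Pow K. card S \<le> \<beta> * card K}"
  let ?r = "card L / t"
  have "0 < card L"
    using assms by (simp add: card_gt_0_iff)
  then have r: "1 \<le> ?r"
    using assms by simp
  have fin: "finite \<S>" and fS: "\<And>S. S \<in> \<S> \<Longrightarrow> finite S"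
    using assms(1) by (auto simp: \<S>_def intro: finite_subset)
  have "real (card (SIGMA S:\<S>. S \<rightarrow>\<^sub>E L)) = (\<Sum>S\<in>\<S>. real (card L) ^ card S)"
  proof -
    have "card (SIGMA S:\<S>. S \<rightarrow>\<^sub>E L) = (\<Sum>S\<in>\<S>. card (S \<rightarrow>\<^sub>E L))"
      using fin fS assms(2) by (intro card_SigmaI) (simp_all add: finite_PiE)
    also have "\<dots> = (\<Sum>S\<in>\<S>. card L ^ card S)"
      using fS by (intro sum.cong) (simp_all add: card_PiE)
    finally show ?thesis by simp
  qed
  also have "\<dots> = (\<Sum>S\<in>\<S>. ?r ^ card S * t ^ card S)"
    using assms(4) by (intro sum.cong) (simp_all add: power_divide)
  also have "\<dots> \<le> (\<Sum>S\<in>\<S>. ?r powr (\<beta> * card K) * t ^ card S)"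
  proof (intro sum_mono mult_right_mono)
    fix S assume "S \<in> \<S>"
    then have "real (card S) \<le> \<beta> * card K"
      by (simp add: \<S>_def)
    then have "?r powr card S \<le> ?r powr (\<beta> * card K)"
      using r by (intro powr_mono) auto
    then show "?r ^ card S \<le> ?r powr (\<beta> * card K)"
      using r by (simp add: powr_realpow)
  qed (use assms in simp)
  also have "\<dots> = ?r powr (\<beta> * card K) * (\<Sum>S\<in>\<S>. t ^ card S)"
    by (simp add: sum_distrib_left)
  also have "\<dots> \<le> ?r powr (\<beta> * card K) * (\<Sum>S\<in>Pow K. t ^ card S)"
    using assms by (intro mult_left_mono sum_mono2) (auto simp: \<S>_def)
  also have "(\<Sum>S\<in>Pow K. t ^ card S) = (1 + t) ^ card K"
    using prod_add[OF assms(1), of "\<lambda>_. t" "\<lambda>_. 1"] by (simp add: add.commute)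
  also have "?r powr (\<beta> * card K) = (?r powr \<beta>) ^ card K"
    using \<open>0 < card L\<close> assms(4) by (subst powr_realpow [symmetric]) (simp_all add: powr_powr)
  finally show ?thesis
    by (simp add: \<S>_def power_mult_distrib mult.commute)
qed

section \<open>Covers and group actions\<close>

lemma cover_number_le:
  assumes "\<V> \<subseteq> \<U>" "finite \<V>" "\<Union>\<V> = topspace T"
  shows "cover_number T \<U> \<le> card \<V>"
  unfolding cover_number_def using assms by (intro Least_le) blast

lemma cover_number_witness:
  assumes "compact_space T" "open_cover T \<U>"
  obtains \<V> where "\<V> \<subseteq> \<U>" "finite \<V>" "\<Union>\<V> = topspace T" "card \<V> = cover_number T \<U>"
proof -
  obtain \<V>' where "\<V>' \<subseteq> \<U>" "finite \<V>'" "\<Union>\<V>' = topspace T"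
    using assms unfolding compact_space open_cover_def by metis
  then have "\<exists>n. \<exists>\<V>\<subseteq>\<U>. finite \<V> \<and> \<Union>\<V> = topspace T \<and> card \<V> = n"
    by (intro exI[of _ "card \<V>'"] exI[of _ \<V>'] conjI refl)
  from LeastI_ex[OF this] show ?thesis
    using that unfolding cover_number_def by blast
qed

lemma cover_number_pos:
  assumes "compact_space T" "open_cover T \<U>" "topspace T \<noteq> {}"
  shows "0 < cover_number T \<U>"
proof -
  obtain \<V> where \<V>: "finite \<V>" "\<Union>\<V> = topspace T" "card \<V> = cover_number T \<U>"
    using cover_number_witness[OF assms(1,2)] by metis
  then have "\<V> \<noteq> {}" using assms(3) by (metis Union_empty)
  with \<V>(1,3) show ?thesis
    by (metis card_gt_0_iff)
qed

lemma dyn_join_memD: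
  assumes "W \<in> dyn_join X \<phi> \<U> F" "f \<in> F"
  obtains U where "U \<in> \<U>" "W \<subseteq> X" "\<And>x. x \<in> W \<Longrightarrow> \<phi> f x \<in> U"
proof -
  obtain V where V: "W = (\<Inter>f\<in>F. V f)" "\<forall>f\<in>F. V f \<in> pullback_cover X (\<phi> f) \<U>"
    using assms(1) by (auto simp: dyn_join_def Join_def)
  then obtain U where U: "U \<in> \<U>" "V f = \<phi> f -` U \<inter> X"
    using assms(2) by (auto simp: pullback_cover_def)
  show ?thesis
    by (rule that[OF U(1)]) (use V(1) U(2) assms(2) in auto)
qed

lemma dyn_join_memI:
  assumes "\<And>f. f \<in> F \<Longrightarrow> U f \<in> \<U>"
  shows "(\<Inter>f\<in>F. \<phi> f -` U f \<inter> X) \<in> dyn_join X \<phi> \<U> F"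
proof -
  have "\<forall>f\<in>F. \<phi> f -` U f \<inter> X \<in> pullback_cover X (\<phi> f) \<U>"
    using assms by (auto simp: pullback_cover_def)
  then show ?thesis
    unfolding dyn_join_def Join_def by (intro CollectI exI[of _ "\<lambda>f. \<phi> f -` U f \<inter> X"] conjI refl)
qed

section \<open>Joins along an action, and Shearer's inequality for orbit words\<close>

context group_action
begin

lemma Union_dyn_join:
  assumes "\<Union>\<U> = E" "F \<subseteq> carrier G" "F \<noteq> {}"
  shows "\<Union>(dyn_join E \<phi> \<U> F) = E"
proof (intro equalityI subsetI)
  fix x assume "x \<in> \<Union>(dyn_join E \<phi> \<U> F)"
  then obtain W where W: "W \<in> dyn_join E \<phi> \<U> F" "x \<in> W" by blast
  obtain f where "f \<in> F" using assms(3) by blast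
  with W show "x \<in> E" by (metis dyn_join_memD subsetD)
next
  fix x assume x: "x \<in> E"
  have "\<forall>f\<in>F. \<exists>U. U \<in> \<U> \<and> \<phi> f x \<in> U"
    using assms(1,2) element_image[OF _ x refl] by (metis UnionE subsetD)
  then obtain U where U: "\<And>f. f \<in> F \<Longrightarrow> U f \<in> \<U>" "\<And>f. f \<in> F \<Longrightarrow> \<phi> f x \<in> U f"
    by metis
  have "x \<in> (\<Inter>f\<in>F. \<phi> f -` U f \<inter> E)"
    using x U(2) by blast
  moreover have "(\<Inter>f\<in>F. \<phi> f -` U f \<inter> E) \<in> dyn_join E \<phi> \<U> F"
    using U(1) by (rule dyn_join_memI)
  ultimately show "x \<in> \<Union>(dyn_join E \<phi> \<U> F)"
    by (rule UnionI[rotated])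
qed

text \<open>Apply Shearer's inequality with windows \<open>K \<inter> F g\<close>, for
  \<open>g\<close> in the set of all \<open>inv f \<otimes> h\<close>. Each \<open>h\<close> lies in
  exactly \<open>card F\<close> windows, one for each \<open>g = inv f \<otimes> h\<close>. The word
  over a window is determined by a member of \<open>\<W>\<close> containing
  \<open>\<phi> g x\<close>: off \<open>B\<close> that member forces the code, and on
  \<open>B\<close> all points of \<open>A\<close> agree by \<open>fibre\<close>. Hence each window
  carries at most \<open>card \<W>\<close> words.\<close>

lemma card_fibre_bound:
  fixes code :: "'c \<Rightarrow> 'l"
  assumes F: "finite F" "F \<noteq> {}" "F \<subseteq> carrier G"
    and K: "finite K" "K \<subseteq> carrier G"
    and \<W>: "finite \<W>" "\<Union>\<W> = E" "\<And>W f. W \<in> \<W> \<Longrightarrow> f \<in> F \<Longrightarrow> \<exists>i\<in>L. \<forall>x\<in>W. \<phi> f x \<in> V i"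
    and agree: "\<And>x i. x \<in> E - B \<Longrightarrow> i \<in> L \<Longrightarrow> x \<in> V i \<Longrightarrow> code x = i"
    and A: "A \<subseteq> E" "finite A" "inj_on (\<lambda>x. \<lambda>h\<in>K. code (\<phi> h x)) A"
    and fibre: "\<And>x y h. x \<in> A \<Longrightarrow> y \<in> A \<Longrightarrow> h \<in> K \<Longrightarrow> \<phi> h x \<in> B \<Longrightarrow>
      \<phi> h y \<in> B \<and> code (\<phi> h x) = code (\<phi> h y)"
  shows "card A ^ card F \<le> card \<W> ^ card (\<Union>f\<in>F. (\<lambda>h. inv f \<otimes> h) ` K)"
proof -
  interpret group G
    using group_hom group_hom.axioms(1) by auto
  define T where "T = (\<Union>f\<in>F. (\<lambda>h. inv f \<otimes> h) ` K)"
  define S where "S g = {h \<in> K. \<exists>f\<in>F. h = f \<otimes> g}" for g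
  have T_iff: "g \<in> T \<longleftrightarrow> (\<exists>f\<in>F. \<exists>h\<in>K. g = inv f \<otimes> h)" for g
    by (auto simp: T_def)
  have finT: "finite T"
    using F(1) K(1) by (simp add: T_def)
  have TG: "T \<subseteq> carrier G"
    using F(3) K(2) by (auto simp: T_iff subset_iff)
  have "card A ^ card F \<le> (\<Prod>g\<in>T. card ((\<lambda>x. \<lambda>h\<in>S g. code (\<phi> h x)) ` A))"
  proof (rule shearer_card[OF K(1) finT A(2) _ _ A(3)])
    show "0 < card F" using F(1,2) by (simp add: card_gt_0_iff)
    fix h assume h: "h \<in> K"
    have "{g \<in> T. h \<in> S g} = (\<lambda>f. inv f \<otimes> h) ` F"
    proof (intro equalityI subsetI)
      fix g assume "g \<in> {g \<in> T. h \<in> S g}"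
      then obtain f where f: "f \<in> F" "h = f \<otimes> g" "g \<in> carrier G"
        using TG by (auto simp: S_def)
      then have "g = inv f \<otimes> h"
        using F(3) by (simp add: inv_solve_left subset_iff)
      with f(1) show "g \<in> (\<lambda>f. inv f \<otimes> h) ` F" by blast
    next
      fix g assume "g \<in> (\<lambda>f. inv f \<otimes> h) ` F"
      then obtain f where f: "f \<in> F" "g = inv f \<otimes> h" by blast
      moreover have "h = f \<otimes> (inv f \<otimes> h)"
        using f(1) h F(3) K(2) by (simp add: m_assoc [symmetric] subset_iff)
      ultimately show "g \<in> {g \<in> T. h \<in> S g}"
        using h by (auto simp: T_iff S_def)
    qed
    moreover have "inj_on (\<lambda>f. inv f \<otimes> h) F"
    proof (rule inj_onI)
      fix f f' assume "f \<in> F" "f' \<in> F" "inv f \<otimes> h = inv f' \<otimes> h"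
      then show "f = f'"
        using h F(3) K(2) by (metis inv_closed inv_inv right_cancel subsetD)
    qed
    ultimately show "card {g \<in> T. h \<in> S g} = card F"
      by (simp add: card_image)
  qed
  also have "\<dots> \<le> (\<Prod>g\<in>T. card \<W>)"
  proof (intro prod_mono conjI)
    fix g assume g: "g \<in> T"
    then have gG: "g \<in> carrier G" using TG by blast
    define q where "q y = (SOME W. W \<in> \<W> \<and> y \<in> W)" for y
    have q: "q y \<in> \<W>" "y \<in> q y" if "y \<in> E" for y
      using someI_ex[of "\<lambda>W. W \<in> \<W> \<and> y \<in> W"] that \<W>(2) unfolding q_def by blast+
    have "card ((\<lambda>x. \<lambda>h\<in>S g. code (\<phi> h x)) ` A) \<le> card ((\<lambda>x. q (\<phi> g x)) ` A)"
    proof (rule card_image_le_of_factor[OF A(2)])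
      fix x y assume xy: "x \<in> A" "y \<in> A" "q (\<phi> g x) = q (\<phi> g y)"
      have E: "x \<in> E" "y \<in> E" "\<phi> g x \<in> E" "\<phi> g y \<in> E"
        using xy A(1) element_image[OF gG _ refl] by blast+
      have "code (\<phi> h x) = code (\<phi> h y)" if h: "h \<in> S g" for h
      proof -
        obtain f where f: "f \<in> F" "h = f \<otimes> g" "h \<in> K"
          using h unfolding S_def by blast
        then have fG: "f \<in> carrier G" using F(3) by blast
        have comp: "\<phi> h x = \<phi> f (\<phi> g x)" "\<phi> h y = \<phi> f (\<phi> g y)"
          unfolding f(2) using E fG gG by (simp_all add: composition_rule)
        have hE: "\<phi> h x \<in> E" "\<phi> h y \<in> E"
          unfolding comp using E(3,4) element_image[OF fG _ refl] by blast+
        \<comment> \<open>A visit of either orbit to \<open>B\<close> settles the matter, as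
          \<open>fibre\<close> can be used in both directions. Otherwise both points lie in the same
          \<open>V i\<close> off \<open>B\<close>, and \<open>agree\<close> gives both the code
          \<open>i\<close>.\<close>
        show ?thesis
        proof (cases "\<phi> h x \<in> B \<or> \<phi> h y \<in> B")
          case True
          then show ?thesis using fibre xy(1,2) f(3) by metis
        next
          case False
          obtain i where i: "i \<in> L" "\<forall>z\<in>q (\<phi> g x). \<phi> f z \<in> V i"
            using \<W>(3)[OF q(1)[OF E(3)] f(1)] by blast
          then have "\<phi> h x \<in> V i" "\<phi> h y \<in> V i"
            unfolding comp using q(2)[OF E(3)] q(2)[OF E(4)] xy(3) by auto
          then show ?thesis
            using agree i(1) False hE by (metis DiffI)
        qed
      qed
      then show "(\<lambda>h\<in>S g. code (\<phi> h x)) = (\<lambda>h\<in>S g. code (\<phi> h y))"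
        by (rule restrict_ext)
    qed
    also have "\<dots> \<le> card \<W>"
      using q(1) A(1) element_image[OF gG _ refl] by (intro card_mono \<W>(1)) blast
    finally show "card ((\<lambda>x. \<lambda>h\<in>S g. code (\<phi> h x)) ` A) \<le> card \<W>" .
  qed simp
  also have "\<dots> = card \<W> ^ card T"
    by (rule prod_constant)
  finally show ?thesis
    unfolding T_def .
qed

text \<open>Fix by pigeonhole the most popular record of visits to \<open>B\<close> and of the codes
  met there. The number of records is bounded by \<open>card_sparse_words\<close>, and the points
  sharing one record satisfy the hypotheses of \<open>card_fibre_bound\<close>.\<close>

lemma card_separated_bound:
  fixes code :: "'c \<Rightarrow> 'l" and t \<beta> :: real
  assumes F: "finite F" "F \<noteq> {}" "F \<subseteq> carrier G"
    and K: "finite K" "K \<subseteq> carrier G"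
    and \<W>: "finite \<W>" "\<Union>\<W> = E" "\<And>W f. W \<in> \<W> \<Longrightarrow> f \<in> F \<Longrightarrow> \<exists>i\<in>L. \<forall>x\<in>W. \<phi> f x \<in> V i"
    and L: "finite L" "L \<noteq> {}"
    and code: "\<And>x. x \<in> E \<Longrightarrow> code x \<in> L"
    and agree: "\<And>x i. x \<in> E - B \<Longrightarrow> i \<in> L \<Longrightarrow> x \<in> V i \<Longrightarrow> code x = i"
    and A: "A \<subseteq> E" "finite A" "inj_on (\<lambda>x. \<lambda>h\<in>K. code (\<phi> h x)) A"
    and few: "\<And>x. x \<in> A \<Longrightarrow> card {h \<in> K. \<phi> h x \<in> B} \<le> \<beta> * card K"
    and t: "0 < t" "t \<le> 1"
  shows "card A \<le> ((1 + t) * (card L / t) powr \<beta>) ^ card K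
    * card \<W> powr (card (\<Union>f\<in>F. (\<lambda>h. inv f \<otimes> h) ` K) / card F)"
proof -
  define T where "T = (\<Union>f\<in>F. (\<lambda>h. inv f \<otimes> h) ` K)"
  define bad where "bad x = {h \<in> K. \<phi> h x \<in> B}" for x
  \<comment> \<open>Points with equal keys visit \<open>B\<close> at the same times with the same codes.\<close>
  define key where "key x = (bad x, \<lambda>h\<in>bad x. code (\<phi> h x))" for x
  define Keys where "Keys = (SIGMA S:{S \<in> Pow K. card S \<le> \<beta> * card K}. S \<rightarrow>\<^sub>E L)"
  have key: "key x \<in> Keys" if "x \<in> A" for x
  proof -
    have "code (\<phi> h x) \<in> L" if "h \<in> bad x" for h
      using that \<open>x \<in> A\<close> A(1) K(2) by (intro code) (auto simp: bad_def intro: element_image[OF _ _ refl])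
    then have "(\<lambda>h\<in>bad x. code (\<phi> h x)) \<in> bad x \<rightarrow>\<^sub>E L"
      by (simp add: restrict_PiE_iff)
    moreover have "bad x \<in> {S \<in> Pow K. card S \<le> \<beta> * card K}"
      using few[OF that] by (auto simp: bad_def)
    ultimately show ?thesis
      by (simp add: key_def Keys_def)
  qed
  have finKeys: "finite Keys"
    unfolding Keys_def using K(1) L(1)
    by (intro finite_SigmaI finite_PiE) (auto intro: finite_subset)
  show ?thesis
  proof (cases "A = {}")
    case False
    then have "Keys \<noteq> {}" using key by blast
    then obtain k where k: "card A \<le> card (key -` {k} \<inter> A) * card Keys"
      using pigeonhole_card[of key A Keys] key A(2) finKeys by (metis Pi_I)
    define A' where "A' = key -` {k} \<inter> A"
    have "card A' ^ card F \<le> card \<W> ^ card T"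
      unfolding T_def
    proof (rule card_fibre_bound[OF F K \<W> agree])
      show "A' \<subseteq> E" "finite A'" "inj_on (\<lambda>x. \<lambda>h\<in>K. code (\<phi> h x)) A'"
        using A by (auto simp: A'_def intro: inj_on_subset)
      fix x y h assume *: "x \<in> A'" "y \<in> A'" "h \<in> K" "\<phi> h x \<in> B"
      then have eq: "bad x = bad y" "(\<lambda>h\<in>bad x. code (\<phi> h x)) = (\<lambda>h\<in>bad y. code (\<phi> h y))"
        by (auto simp: A'_def key_def)
      have h: "h \<in> bad x" "h \<in> bad y"
        using * eq(1) by (auto simp: bad_def)
      then have "code (\<phi> h x) = code (\<phi> h y)"
        using fun_cong[OF eq(2), of h] by simp
      with h(2) show "\<phi> h y \<in> B \<and> code (\<phi> h x) = code (\<phi> h y)"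
        by (simp add: bad_def)
    qed auto
    then have "real (card A') ^ card F \<le> real (card \<W>) ^ card T"
      by (metis of_nat_le_iff of_nat_power)
    \<comment> \<open>The root of order \<open>card F\<close> produces the exponent
      \<open>card T / card F\<close>, the quotient that the Folner property controls later.\<close>
    then have *: "(real (card A') ^ card F) powr (1 / card F) \<le> (real (card \<W>) ^ card T) powr (1 / card F)"
      by (intro powr_mono2) auto
    have "0 < card \<W>"
    proof -
      have "\<W> \<noteq> {}" using False A(1) \<W>(2) by blast
      then show ?thesis using \<W>(1) by (simp add: card_gt_0_iff)
    qed
    have "0 < card F" using F(1,2) by (simp add: card_gt_0_iff)
    then have "(real (card A') ^ card F) powr (1 / card F) = card A'"
      by (cases "card A' = 0") (simp_all add: powr_realpow [symmetric] powr_powr)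
    moreover have "(real (card \<W>) ^ card T) powr (1 / card F) = card \<W> powr (card T / card F)"
      using \<open>0 < card \<W>\<close> by (simp add: powr_realpow [symmetric] powr_powr)
    ultimately have A': "real (card A') \<le> card \<W> powr (card T / card F)"
      using * by simp
    have "real (card A) \<le> real (card Keys) * real (card A')"
      using k unfolding A'_def by (metis mult.commute of_nat_le_iff of_nat_mult)
    also have "\<dots> \<le> ((1 + t) * (card L / t) powr \<beta>) ^ card K * card \<W> powr (card T / card F)"
      unfolding Keys_def using t by (intro mult_mono A' card_sparse_words K(1) L) auto
    finally show ?thesis by (simp add: T_def)
  qed (use t in simp)
qed

end

section \<open>Folner sequences\<close>

lemma folner_eventually_almost_invariant:
  fixes \<eta> :: real
  assumes "folner_sequence G F" "finite S" "S \<subseteq> carrier G" "0 < \<eta>"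
  shows "\<forall>\<^sub>F n in sequentially. \<forall>g\<in>S.
    real (card (sym_diff (F n) (l_coset G g (F n)))) < \<eta> * card (F n)"
proof (rule eventually_ball_finite[OF assms(2)], rule ballI)
  fix g assume "g \<in> S"
  then have "g \<in> carrier G"
    using assms(3) by blast
  then have "(\<lambda>n. real (card (sym_diff (F n) (l_coset G g (F n)))) / card (F n)) \<longlonglongrightarrow> 0"
    using assms(1) by (simp add: folner_sequence_def)
  then have "\<forall>\<^sub>F n in sequentially.
      real (card (sym_diff (F n) (l_coset G g (F n)))) / card (F n) < \<eta>"
    using assms(4) by (rule order_tendstoD)
  then show "\<forall>\<^sub>F n in sequentially. real (card (sym_diff (F n) (l_coset G g (F n)))) < \<eta> * card (F n)"
  proof eventually_elim
    case (elim n)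
    have "0 < card (F n)"
      using assms(1) by (simp add: folner_sequence_def card_gt_0_iff)
    with elim show ?case
      by (simp add: pos_divide_less_eq)
  qed
qed

context group
begin

lemma card_l_coset:
  assumes "g \<in> carrier G" "K \<subseteq> carrier G"
  shows "card (l_coset G g K) = card K"
proof -
  have "l_coset G g K = (\<lambda>h. g \<otimes> h) ` K"
    by (auto simp: l_coset_def)
  moreover have "inj_on (\<lambda>h. g \<otimes> h) K"
    using assms by (auto simp: inj_on_def subset_iff)
  ultimately show ?thesis
    by (simp add: card_image)
qed

text \<open>Every translate by \<open>inv f\<close> exceeds \<open>F n\<close> only inside a small
  symmetric difference, and finitely many of these are summed.\<close>

lemma folner_card_translates:
  fixes \<eta> :: real
  assumes F: "folner_sequence G F" and S: "finite S" "S \<subseteq> carrier G" and "0 < \<eta>"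
  shows "\<forall>\<^sub>F n in sequentially.
    card (\<Union>f\<in>S. (\<lambda>h. inv f \<otimes> h) ` F n) \<le> (1 + \<eta>) * card (F n)"
proof -
  \<comment> \<open>The added 1 covers empty \<open>S\<close> and still gives
    \<open>card S * c \<le> \<eta>\<close>.\<close>
  define c where "c = \<eta> / (card S + 1)"
  have "0 < c" using \<open>0 < \<eta>\<close> by (simp add: c_def)
  have "(\<lambda>f. inv f) ` S \<subseteq> carrier G" using S(2) by auto
  from folner_eventually_almost_invariant[OF F finite_imageI[OF S(1)] this \<open>0 < c\<close>]
  show ?thesis
  proof eventually_elim
    case (elim n)
    have fin: "finite (F n)"
      using F by (simp add: folner_sequence_def)
    define D where "D f = sym_diff (F n) (l_coset G (inv f) (F n))" for f
    have coset: "l_coset G (inv f) (F n) = (\<lambda>h. inv f \<otimes> h) ` F n" for f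
      by (auto simp: l_coset_def)
    have finD: "finite (D f)" for f
      unfolding D_def coset using fin by simp
    have "(\<Union>f\<in>S. (\<lambda>h. inv f \<otimes> h) ` F n) \<subseteq> F n \<union> (\<Union>f\<in>S. D f)"
      unfolding D_def coset by blast
    then have "card (\<Union>f\<in>S. (\<lambda>h. inv f \<otimes> h) ` F n) \<le> card (F n \<union> (\<Union>f\<in>S. D f))"
      using fin S(1) finD by (intro card_mono) auto
    also have "\<dots> \<le> card (F n) + (\<Sum>f\<in>S. card (D f))"
      using card_Un_le card_UN_le[OF S(1), of D] by (meson add_left_mono order_trans)
    finally have "real (card (\<Union>f\<in>S. (\<lambda>h. inv f \<otimes> h) ` F n)) \<le> card (F n) + (\<Sum>f\<in>S. real (card (D f)))"
      by (metis of_nat_add of_nat_le_iff of_nat_sum)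
    also have "(\<Sum>f\<in>S. real (card (D f))) \<le> (\<Sum>f\<in>S. c * card (F n))"
      using elim by (intro sum_mono) (auto simp: D_def less_imp_le)
    also have "\<dots> = (card S * c) * card (F n)"
      by simp
    also have "\<dots> \<le> \<eta> * card (F n)"
      using \<open>0 < \<eta>\<close> by (intro mult_right_mono) (simp_all add: c_def field_simps)
    finally show ?case
      by (simp add: distrib_right)
  qed
qed

text \<open>If \<open>F n\<close> is disjoint from its translate by \<open>g\<close>, their
  symmetric difference has at least \<open>card (F n)\<close> elements. So for large
  \<open>n\<close> every \<open>g\<close> in a prescribed set \<open>S\<close> of
  \<open>C * C\<close> elements is a quotient of two elements of \<open>F n\<close>, and there are
  at most \<open>card (F n)\<close> squared such quotients.\<close>

lemma folner_card_unbounded: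
  assumes F: "folner_sequence G F" and inf: "infinite (carrier G)"
  shows "\<forall>\<^sub>F n in sequentially. C \<le> card (F n)"
proof -
  obtain S where S: "S \<subseteq> carrier G" "finite S" "card S = C * C"
    using infinite_arbitrarily_large[OF inf] by blast
  have F_n: "finite (F n)" "F n \<subseteq> carrier G" for n
    using F by (auto simp: folner_sequence_def)
  have "\<forall>\<^sub>F n in sequentially. \<forall>g\<in>S.
      real (card (sym_diff (F n) (l_coset G g (F n)))) < (1::real) * card (F n)"
    by (rule folner_eventually_almost_invariant[OF F S(2,1)]) simp
  then show ?thesis
  proof eventually_elim
    case (elim n)
    have "S \<subseteq> (\<lambda>(x, y). x \<otimes> inv y) ` (F n \<times> F n)"
    proof
      fix g assume g: "g \<in> S"
      then have gG: "g \<in> carrier G" using S(1) by blast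
      have "F n \<inter> l_coset G g (F n) \<noteq> {}"
      proof
        assume "F n \<inter> l_coset G g (F n) = {}"
        then have "l_coset G g (F n) \<subseteq> sym_diff (F n) (l_coset G g (F n))"
          by blast
        moreover have "finite (l_coset G g (F n))"
          using F_n(1) by (simp add: l_coset_def)
        ultimately have "card (l_coset G g (F n)) \<le> card (sym_diff (F n) (l_coset G g (F n)))"
          using F_n(1) by (intro card_mono) auto
        then show False
          using elim g card_l_coset[OF gG F_n(2)] by fastforce
      qed
      then obtain x y where xy: "x \<in> F n" "y \<in> F n" "x = g \<otimes> y"
        by (auto simp: l_coset_def)
      then have "g = x \<otimes> inv y"
        using gG F_n(2) by (simp add: m_assoc subset_iff)
      with xy(1,2) show "g \<in> (\<lambda>(x, y). x \<otimes> inv y) ` (F n \<times> F n)"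
        by auto
    qed
    then have "card S \<le> card (F n \<times> F n)"
      using F_n(1) by (intro surj_card_le) auto
    then have "C\<^sup>2 \<le> (card (F n))\<^sup>2"
      by (simp add: S(3) card_cartesian_product power2_eq_square)
    then show ?case
      by (rule power2_le_imp_le) simp
  qed
qed

lemma folner_finite:
  assumes F: "folner_sequence G F" and fin: "finite (carrier G)"
  shows "\<forall>\<^sub>F n in sequentially. F n = carrier G"
proof -
  have F_n: "F n \<noteq> {}" "F n \<subseteq> carrier G" for n
    using F by (auto simp: folner_sequence_def)
  have "0 < card (carrier G)"
    using fin one_closed by (auto simp: card_gt_0_iff)
  then have "\<forall>\<^sub>F n in sequentially. \<forall>g\<in>carrier G.
      real (card (sym_diff (F n) (l_coset G g (F n)))) < 1 / card (carrier G) * card (F n)"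
    by (intro folner_eventually_almost_invariant[OF F fin]) simp_all
  then show ?thesis
  proof eventually_elim
    case (elim n)
    obtain x where x: "x \<in> F n" using F_n(1) by blast
    have "y \<in> F n" if y: "y \<in> carrier G" for y
    proof -
      let ?g = "y \<otimes> inv x" and ?K = "F n"
      have g: "?g \<in> carrier G" using x y F_n(2) by auto
      \<comment> \<open>The tolerance \<open>1 / card (carrier G)\<close> makes the symmetric
        difference have fewer than one element, so \<open>F n\<close> is invariant under all left
        translations.\<close>
      have "1 / card (carrier G) * card ?K \<le> 1"
        using card_mono[OF fin F_n(2)] \<open>0 < card (carrier G)\<close> by simp
      then have "real (card (sym_diff ?K (l_coset G ?g ?K))) < 1"
        using elim g by fastforce
      then have "card (sym_diff ?K (l_coset G ?g ?K)) = 0"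
        by linarith
      moreover have "finite ?K" "finite (l_coset G ?g ?K)"
        using finite_subset[OF F_n(2) fin] by (simp_all add: l_coset_def)
      ultimately have eq: "l_coset G ?g ?K \<subseteq> ?K"
        by auto
      have "?g \<otimes> x \<in> l_coset G ?g ?K"
        using x by (auto simp: l_coset_def)
      moreover have "?g \<otimes> x = y"
        using x y F_n(2) by (simp add: m_assoc subset_iff)
      ultimately show ?thesis
        using eq by auto
    qed
    then show ?case
      using F_n(2) by blast
  qed
qed

end

section \<open>Monotonicity of cover numbers under joins, and finite groups\<close>

context group_action
begin

lemma open_cover_dyn_join:
  assumes T: "topspace T = E" and cont: "\<And>g. g \<in> carrier G \<Longrightarrow> continuous_map T T (\<phi> g)"
    and \<U>: "open_cover T \<U>" and F: "finite F" "F \<noteq> {}" "F \<subseteq> carrier G"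
  shows "open_cover T (dyn_join E \<phi> \<U> F)"
  unfolding open_cover_def
proof (intro conjI ballI)
  fix W assume "W \<in> dyn_join E \<phi> \<U> F"
  then obtain V where V: "W = (\<Inter>f\<in>F. V f)" "\<forall>f\<in>F. V f \<in> pullback_cover E (\<phi> f) \<U>"
    by (auto simp: dyn_join_def Join_def)
  have "openin T (V f)" if f: "f \<in> F" for f
  proof -
    obtain U where U: "U \<in> \<U>" "V f = \<phi> f -` U \<inter> E"
      using V(2) f by (auto simp: pullback_cover_def)
    have "openin T {x \<in> topspace T. \<phi> f x \<in> U}"
      using cont[of f] U(1) \<U> f F(3) by (intro openin_continuous_map_preimage) (auto simp: open_cover_def)
    moreover have "{x \<in> topspace T. \<phi> f x \<in> U} = V f"
      using U(2) T by blast
    ultimately show ?thesis by simp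
  qed
  then show "openin T W"
    unfolding V(1) using F(1,2) by (intro openin_INT2) auto
next
  show "\<Union>(dyn_join E \<phi> \<U> F) = topspace T"
    unfolding T using \<U> F(2,3) by (intro Union_dyn_join) (simp_all add: open_cover_def T)
qed

text \<open>One \<open>f\<close> in \<open>F\<close> suffices: \<open>\<phi> f\<close> maps each
  member of a subcover of the join into a member of \<open>\<U>\<close>, and the members so obtained
  cover \<open>E\<close> because \<open>\<phi> f\<close> is onto.\<close>

lemma cover_number_le_dyn_join:
  assumes T: "compact_space T" "topspace T = E"
    and cont: "\<And>g. g \<in> carrier G \<Longrightarrow> continuous_map T T (\<phi> g)"
    and \<U>: "open_cover T \<U>" and F: "finite F" "F \<noteq> {}" "F \<subseteq> carrier G"
  shows "cover_number T \<U> \<le> cover_number T (dyn_join E \<phi> \<U> F)"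
proof -
  have "open_cover T (dyn_join E \<phi> \<U> F)"
    using assms by (intro open_cover_dyn_join)
  then obtain \<W> where \<W>: "\<W> \<subseteq> dyn_join E \<phi> \<U> F" "finite \<W>" "\<Union>\<W> = E"
      "card \<W> = cover_number T (dyn_join E \<phi> \<U> F)"
    using T by (metis cover_number_witness)
  obtain f where f: "f \<in> F" "f \<in> carrier G"
    using F(2,3) by blast
  have "\<forall>W\<in>\<W>. \<exists>U. U \<in> \<U> \<and> (\<forall>x\<in>W. \<phi> f x \<in> U)"
    using \<W>(1) f(1) by (meson dyn_join_memD subsetD)
  then obtain u where u: "\<And>W. W \<in> \<W> \<Longrightarrow> u W \<in> \<U>" "\<And>W x. W \<in> \<W> \<Longrightarrow> x \<in> W \<Longrightarrow> \<phi> f x \<in> u W"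
    by metis
  have "E \<subseteq> \<Union>(u ` \<W>)"
  proof
    fix y assume "y \<in> E"
    then obtain x where x: "x \<in> E" "\<phi> f x = y"
      using bij_prop1[OF f(2)] by blast
    then obtain W where "W \<in> \<W>" "x \<in> W"
      using \<W>(3) by blast
    then show "y \<in> \<Union>(u ` \<W>)"
      using u(2) x(2) by blast
  qed
  moreover have "\<Union>(u ` \<W>) \<subseteq> E"
    using u(1) \<U> T(2) unfolding open_cover_def by blast
  ultimately have "cover_number T \<U> \<le> card (u ` \<W>)"
    using u(1) \<W>(2) T(2) by (intro cover_number_le) auto
  also have "\<dots> \<le> card \<W>"
    by (rule card_image_le[OF \<W>(2)])
  finally show ?thesis
    by (simp add: \<W>(4))
qed

lemma h_top_cover_le_finite_group:
  assumes T: "compact_space T" "topspace T = E" "E \<noteq> {}"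
    and cont: "\<And>g. g \<in> carrier G \<Longrightarrow> continuous_map T T (\<phi> g)"
    and \<U>: "open_cover T \<U>" and F: "folner_sequence G F" and fin: "finite (carrier G)"
  shows "h_top_cover T \<phi> F \<U> \<le> h_top_star T G \<phi>"
proof -
  interpret group G
    using group_hom group_hom.axioms(1) by auto
  define \<V> where "\<V> = dyn_join E \<phi> \<U> (carrier G)"
  define c where "c = ereal (1 / real (card (carrier G)) * H_top T \<V>)"
  have "carrier G \<noteq> {}" using one_closed by blast
  have \<V>: "open_cover T \<V>"
    unfolding \<V>_def
    by (rule open_cover_dyn_join[OF T(2) _ \<U> fin \<open>carrier G \<noteq> {}\<close> subset_refl]) (rule cont)
  have "h_top_cover T \<phi> F \<U> \<le> c"
    unfolding h_top_cover_def
  proof (rule Limsup_bounded, rule eventually_mono[OF folner_finite[OF F fin]])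
    fix n assume "F n = carrier G"
    then show "ereal (1 / real (card (F n)) * H_top T (dyn_join (topspace T) \<phi> \<U> (F n))) \<le> c"
      unfolding c_def \<V>_def T(2) by (simp only: order_refl)
  qed
  also have "c \<le> h_top_star_cover T G \<phi> \<V>"
    unfolding h_top_star_cover_def
  proof (rule INF_greatest)
    fix S assume "S \<in> {S. S \<noteq> {} \<and> finite S \<and> S \<subseteq> carrier G}"
    then have S: "S \<noteq> {}" "finite S" "S \<subseteq> carrier G" by auto
    \<comment> \<open>Positivity makes the logarithm nonnegative and monotone here, so both factors
      can be compared separately.\<close>
    have "0 < cover_number T \<V>"
      using T \<V> by (simp add: cover_number_pos)
    moreover have "cover_number T \<V> \<le> cover_number T (dyn_join E \<phi> \<V> S)"
      using T(1,2) cont \<V> S(2,1,3) by (rule cover_number_le_dyn_join)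
    ultimately have "0 \<le> H_top T \<V>" "H_top T \<V> \<le> H_top T (dyn_join E \<phi> \<V> S)"
      by (simp_all add: H_top_def)
    moreover have "1 / real (card (carrier G)) \<le> 1 / real (card S)"
      using S fin by (intro divide_left_mono) (simp_all add: card_mono card_gt_0_iff \<open>carrier G \<noteq> {}\<close>)
    ultimately show "c \<le> ereal (1 / real (card S) * H_top T (dyn_join (topspace T) \<phi> \<V> S))"
      unfolding c_def T(2) ereal_less_eq(3) by (intro mult_mono) simp_all
  qed
  also have "\<dots> \<le> h_top_star T G \<phi>"
    unfolding h_top_star_def using \<V> by (intro SUP_upper) simp
  finally show ?thesis .
qed

end

section \<open>Separated sets and shells\<close>

text \<open>Averaging: \<open>m\<close> disjoint fibres cannot all exceed the share
  \<open>card K / m\<close>. It will be applied with \<open>P j h\<close> saying that the orbit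
  point at \<open>h\<close> lies in the \<open>j\<close>-th shell around a fixed centre.\<close>

lemma ex_light_fibre:
  assumes "finite K" "0 < m"
    and disj: "\<And>i j h. i < m \<Longrightarrow> j < m \<Longrightarrow> h \<in> K \<Longrightarrow> P i h \<Longrightarrow> P j h \<Longrightarrow> i = j"
  shows "\<exists>j<m. card {h \<in> K. P j h} * m \<le> card K"
proof (rule ccontr)
  assume "\<not> ?thesis"
  then have "(\<Sum>j<m. card K) < (\<Sum>j<m. card {h \<in> K. P j h} * m)"
    using \<open>0 < m\<close> by (intro sum_strict_mono) auto
  also have "\<dots> = (\<Sum>j<m. card {h \<in> K. P j h}) * m"
    by (simp add: sum_distrib_right)
  also have "(\<Sum>j<m. card {h \<in> K. P j h}) = card (\<Union>j<m. {h \<in> K. P j h})"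
    using assms by (intro card_UN_disjoint [symmetric]) auto
  also have "\<dots> \<le> card K"
    using assms(1) by (intro card_mono) auto
  finally show False
    by (simp add: mult.commute)
qed

context Metric_space
begin

lemma ex_Lebesgue_number:
  assumes compact: "compact_space mtopology" and \<U>: "open_cover mtopology \<U>"
  obtains \<epsilon> where "0 < \<epsilon>" "\<And>x. x \<in> M \<Longrightarrow> \<exists>U\<in>\<U>. mball x \<epsilon> \<subseteq> U"
proof -
  have "\<forall>x\<in>M. \<exists>r>0. \<exists>U\<in>\<U>. mball x r \<subseteq> U"
    using \<U> unfolding open_cover_def topspace_mtopology openin_mtopology by blast
  then obtain r where r: "\<And>x. x \<in> M \<Longrightarrow> 0 < r x" "\<And>x. x \<in> M \<Longrightarrow> \<exists>U\<in>\<U>. mball x (r x) \<subseteq> U"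
    by metis
  have "\<Union>((\<lambda>x. mball x (r x / 2)) ` M) = topspace mtopology"
    using r(1) by fastforce
  moreover have "\<forall>U\<in>(\<lambda>x. mball x (r x / 2)) ` M. openin mtopology U"
    by blast
  ultimately obtain \<F> where \<F>: "finite \<F>" "\<F> \<subseteq> (\<lambda>x. mball x (r x / 2)) ` M" "\<Union>\<F> = M"
    using compact unfolding compact_space topspace_mtopology by meson
  then obtain Z where Z: "Z \<subseteq> M" "finite Z" "\<F> = (\<lambda>x. mball x (r x / 2)) ` Z"
    by (meson finite_subset_image)
  \<comment> \<open>The inserted 1 keeps \<open>Min\<close> meaningful when \<open>Z\<close> is
    empty.\<close>
  define \<epsilon> where "\<epsilon> = Min (insert 1 ((\<lambda>x. r x / 2) ` Z))"
  show ?thesis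
  proof
    show "0 < \<epsilon>"
      using Z(1,2) r(1) by (auto simp: \<epsilon>_def)
    fix x assume "x \<in> M"
    then obtain z where z: "z \<in> Z" "x \<in> mball z (r z / 2)"
      using \<F>(3) Z(3) by blast
    then obtain U where U: "U \<in> \<U>" "mball z (r z) \<subseteq> U"
      using r(2) Z(1) by blast
    have "\<epsilon> \<le> r z / 2"
      unfolding \<epsilon>_def using Z(2) z(1) by (intro Min_le) auto
    then have "mball x \<epsilon> \<subseteq> mball z (r z)"
      using z(2) by (intro mball_subset) (auto simp: commute)
    then show "\<exists>U\<in>\<U>. mball x \<epsilon> \<subseteq> U"
      using U by blast
  qed
qed

text \<open>Recording the nearby points of a finite net at radius \<open>\<epsilon> / 2\<close>
  along \<open>K\<close> is injective on a separated set, which bounds its cardinality. A separated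
  set of greatest cardinality is spanning, since any point far from it could be added.\<close>

lemma ex_maximal_separated:
  assumes tb: "mtotally_bounded M" and "0 < \<epsilon>" and K: "finite K"
    and \<phi>: "\<And>h x. h \<in> K \<Longrightarrow> x \<in> M \<Longrightarrow> \<phi> h x \<in> M"
  obtains A where "finite A" "A \<subseteq> M"
    "\<And>x y. x \<in> A \<Longrightarrow> y \<in> A \<Longrightarrow> x \<noteq> y \<Longrightarrow> \<exists>h\<in>K. \<epsilon> \<le> d (\<phi> h x) (\<phi> h y)"
    "\<And>x. x \<in> M \<Longrightarrow> \<exists>y\<in>A. \<forall>h\<in>K. d (\<phi> h y) (\<phi> h x) < \<epsilon>"
proof -
  define sep where "sep A \<longleftrightarrow> A \<subseteq> M \<and>
    (\<forall>x\<in>A. \<forall>y\<in>A. x \<noteq> y \<longrightarrow> (\<exists>h\<in>K. \<epsilon> \<le> d (\<phi> h x) (\<phi> h y)))" for A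
  obtain Z where Z: "finite Z" "Z \<subseteq> M" "M \<subseteq> (\<Union>z\<in>Z. mball z (\<epsilon> / 2))"
    using tb \<open>0 < \<epsilon>\<close> unfolding mtotally_bounded_def by (meson half_gt_zero)
  then have "\<forall>x\<in>M. \<exists>z\<in>Z. d z x < \<epsilon> / 2"
    by force
  then obtain c where c: "\<And>x. x \<in> M \<Longrightarrow> c x \<in> Z" "\<And>x. x \<in> M \<Longrightarrow> d (c x) x < \<epsilon> / 2"
    by metis
  have sep_card: "finite A \<and> card A \<le> card (K \<rightarrow>\<^sub>E Z)" if A: "sep A" for A
  proof -
    let ?w = "\<lambda>x. \<lambda>h\<in>K. c (\<phi> h x)"
    have fin: "finite (K \<rightarrow>\<^sub>E Z)"
      using K Z(1) by (simp add: finite_PiE)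
    have "inj_on ?w A"
    proof (rule inj_onI, rule ccontr)
      fix x y assume xy: "x \<in> A" "y \<in> A" "?w x = ?w y" "x \<noteq> y"
      then obtain h where h: "h \<in> K" "\<epsilon> \<le> d (\<phi> h x) (\<phi> h y)"
        using A unfolding sep_def by blast
      have M: "\<phi> h x \<in> M" "\<phi> h y \<in> M"
        using A xy(1,2) \<phi>[OF h(1)] unfolding sep_def by blast+
      have "c (\<phi> h x) = c (\<phi> h y)"
        using fun_cong[OF xy(3), of h] h(1) by simp
      moreover have "c (\<phi> h x) \<in> M"
        using c(1)[OF M(1)] Z(2) by blast
      ultimately show False
        using c(2)[OF M(1)] c(2)[OF M(2)] h(2) triangle[OF M(1) _ M(2)] commute
        by (smt (verit) field_sum_of_halves)
    qed
    moreover have "?w ` A \<subseteq> K \<rightarrow>\<^sub>E Z"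
    proof (rule image_subsetI)
      fix x assume "x \<in> A"
      then have "\<forall>h\<in>K. c (\<phi> h x) \<in> Z"
        using A \<phi> c(1) unfolding sep_def by blast
      then show "?w x \<in> K \<rightarrow>\<^sub>E Z"
        by (simp add: restrict_PiE_iff)
    qed
    ultimately show ?thesis
      using fin by (meson card_inj_on_le inj_on_finite)
  qed
  have "sep {}" by (simp add: sep_def)
  moreover have "\<forall>A. sep A \<longrightarrow> card A < Suc (card (K \<rightarrow>\<^sub>E Z))"
    using sep_card by (simp add: less_Suc_eq_le)
  ultimately obtain A where A: "sep A" "\<And>A'. sep A' \<Longrightarrow> card A' \<le> card A"
    using ex_has_greatest_nat[of sep "{}" card] by metis
  show ?thesis
  proof
    show "finite A"
      using sep_card[OF A(1)] by simp
    show "A \<subseteq> M"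
      using A(1) by (simp add: sep_def)
    show "\<exists>h\<in>K. \<epsilon> \<le> d (\<phi> h x) (\<phi> h y)" if "x \<in> A" "y \<in> A" "x \<noteq> y" for x y
      using A(1) that by (simp add: sep_def)
    fix x assume x: "x \<in> M"
    show "\<exists>y\<in>A. \<forall>h\<in>K. d (\<phi> h y) (\<phi> h x) < \<epsilon>"
    proof (rule ccontr)
      assume "\<not> ?thesis"
      then have far: "\<And>y. y \<in> A \<Longrightarrow> \<exists>h\<in>K. \<epsilon> \<le> d (\<phi> h y) (\<phi> h x)"
        by (meson not_le)
      have "x \<notin> A"
        using far[of x] \<phi>[OF _ x] \<open>0 < \<epsilon>\<close> by fastforce
      moreover have "sep (insert x A)"
        using A(1) far x unfolding sep_def by (auto simp: commute)
      ultimately show False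
        using A(2)[of "insert x A"] sep_card[OF A(1)] by simp
    qed
  qed
qed

text \<open>The open sets \<open>shell_cover z r s i\<close> refine the balls of radius \<open>s i\<close> around \<open>z i\<close>, and they
  disagree with the partition coded by \<open>ball_code z r\<close> only on the shells between the radii
  \<open>r i\<close> and \<open>s i\<close>.\<close>

definition shell_cover :: "(nat \<Rightarrow> 'a) \<Rightarrow> (nat \<Rightarrow> real) \<Rightarrow> (nat \<Rightarrow> real) \<Rightarrow> nat \<Rightarrow> 'a set" where
  "shell_cover z r s i = mball (z i) (s i) - (\<Union>k<i. mcball (z k) (r k))"

definition ball_code :: "(nat \<Rightarrow> 'a) \<Rightarrow> (nat \<Rightarrow> real) \<Rightarrow> 'a \<Rightarrow> nat" where
  "ball_code z r x = (LEAST i. x \<in> mball (z i) (r i))"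

lemma ball_code:
  assumes "M \<subseteq> (\<Union>i<p. mball (z i) (r i))" "x \<in> M"
  shows "ball_code z r x < p" "x \<in> mball (z (ball_code z r x)) (r (ball_code z r x))"
proof -
  obtain i where i: "i < p" "x \<in> mball (z i) (r i)"
    using assms by blast
  show "x \<in> mball (z (ball_code z r x)) (r (ball_code z r x))"
    unfolding ball_code_def using i(2) by (rule LeastI)
  have "ball_code z r x \<le> i"
    unfolding ball_code_def using i(2) by (rule Least_le)
  with i(1) show "ball_code z r x < p" by simp
qed

text \<open>A point is covered at the least index \<open>i\<close> whose larger ball, of radius
  \<open>s i\<close>, contains it: missing an earlier larger ball, it also misses the closed ball of
  the smaller radius.\<close>

lemma open_cover_shell_cover:
  assumes cover: "M \<subseteq> (\<Union>i<p. mball (z i) (r i))" and rs: "\<And>i. r i < s i"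
  shows "open_cover mtopology (shell_cover z r s ` {..<p})"
  unfolding open_cover_def
proof (intro conjI ballI)
  fix U assume "U \<in> shell_cover z r s ` {..<p}"
  then show "openin mtopology U"
    by (auto simp: shell_cover_def intro!: openin_diff closedin_Union)
next
  have "M \<subseteq> \<Union>(shell_cover z r s ` {..<p})"
  proof
    fix x assume x: "x \<in> M"
    have cover': "M \<subseteq> (\<Union>i<p. mball (z i) (s i))"
      using cover rs by (force intro: less_trans)
    have "x \<notin> mcball (z k) (r k)" if "k < ball_code z s x" for k
    proof -
      have "x \<notin> mball (z k) (s k)"
        using that not_less_Least unfolding ball_code_def by blast
      then show ?thesis
        using rs[of k] by auto
    qed
    then have "x \<in> shell_cover z r s (ball_code z s x)"
      using ball_code(2)[OF cover' x] by (simp add: shell_cover_def)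
    then show "x \<in> \<Union>(shell_cover z r s ` {..<p})"
      using ball_code(1)[OF cover' x] by blast
  qed
  moreover have "\<Union>(shell_cover z r s ` {..<p}) \<subseteq> M"
    by (auto simp: shell_cover_def)
  ultimately show "\<Union>(shell_cover z r s ` {..<p}) = topspace mtopology"
    by simp
qed

text \<open>Off the shells, lying within \<open>s i\<close> of \<open>z i\<close> means lying within
  \<open>r i\<close>, and membership in \<open>shell_cover\<close> excludes all earlier
  balls.\<close>

lemma ball_code_eq:
  assumes x: "x \<in> shell_cover z r s i" "i < p"
    and off: "\<And>i. i < p \<Longrightarrow> \<not> (r i \<le> d (z i) x \<and> d (z i) x < s i)"
  shows "ball_code z r x = i"
  unfolding ball_code_def
proof (rule Least_equality)
  show "x \<in> mball (z i) (r i)"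
    using x off[of i] by (auto simp: shell_cover_def)
  fix k assume "x \<in> mball (z k) (r k)"
  then have "x \<in> mcball (z k) (r k)" by auto
  then show "i \<le> k"
    using x(1) unfolding shell_cover_def by (meson DiffD2 UN_I lessThan_iff not_le)
qed

text \<open>Each \<open>y\<close> in \<open>A\<close> yields one member of the join, built from sets
  of \<open>\<U>\<close> containing the \<open>\<epsilon>\<close>-balls around the points
  \<open>\<phi> h y\<close>; spanning makes these members cover.\<close>

lemma cover_number_dyn_join_le_spanning:
  assumes leb: "\<And>x. x \<in> M \<Longrightarrow> \<exists>U\<in>\<U>. mball x \<epsilon> \<subseteq> U"
    and K: "K \<noteq> {}" and \<phi>: "\<And>h x. h \<in> K \<Longrightarrow> x \<in> M \<Longrightarrow> \<phi> h x \<in> M"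
    and A: "finite A" "A \<subseteq> M"
    and span: "\<And>x. x \<in> M \<Longrightarrow> \<exists>y\<in>A. \<forall>h\<in>K. d (\<phi> h y) (\<phi> h x) < \<epsilon>"
  shows "cover_number mtopology (dyn_join M \<phi> \<U> K) \<le> card A"
proof -
  obtain u where u: "\<And>x. x \<in> M \<Longrightarrow> u x \<in> \<U>" "\<And>x. x \<in> M \<Longrightarrow> mball x \<epsilon> \<subseteq> u x"
    using leb by metis
  define W where "W y = (\<Inter>h\<in>K. \<phi> h -` u (\<phi> h y) \<inter> M)" for y
  have "W ` A \<subseteq> dyn_join M \<phi> \<U> K"
  proof (rule image_subsetI)
    fix y assume y: "y \<in> A"
    show "W y \<in> dyn_join M \<phi> \<U> K"
      unfolding W_def using u(1) \<phi> y A(2) by (intro dyn_join_memI) blast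
  qed
  moreover have "\<Union>(W ` A) = topspace mtopology"
  proof (intro equalityI subsetI)
    fix x assume "x \<in> \<Union>(W ` A)"
    then show "x \<in> topspace mtopology"
      using K by (auto simp: W_def)
  next
    fix x assume "x \<in> topspace mtopology"
    then have x: "x \<in> M" by simp
    then obtain y where y: "y \<in> A" "\<forall>h\<in>K. d (\<phi> h y) (\<phi> h x) < \<epsilon>"
      using span by blast
    have "\<phi> h x \<in> u (\<phi> h y)" if "h \<in> K" for h
    proof -
      have "\<phi> h y \<in> M" "\<phi> h x \<in> M"
        using \<phi>[OF that] x y(1) A(2) by blast+
      then have "\<phi> h x \<in> mball (\<phi> h y) \<epsilon>"
        using y(2) that by simp
      then show ?thesis
        using u(2) \<open>\<phi> h y \<in> M\<close> by blast
    qed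
    then have "x \<in> W y"
      using x by (simp add: W_def)
    then show "x \<in> \<Union>(W ` A)"
      using y(1) by blast
  qed
  ultimately have "cover_number mtopology (dyn_join M \<phi> \<U> K) \<le> card (W ` A)"
    using A(1) by (intro cover_number_le) simp_all
  also have "\<dots> \<le> card A"
    by (rule card_image_le[OF A(1)])
  finally show ?thesis .
qed

end

section \<open>Comparison of the two entropies\<close>

text \<open>The central estimate. Each point of \<open>A\<close> selects a light shell around every
  centre; the \<open>m ^ p\<close> possible selections cost the term \<open>p * ln m\<close>. Points
  with a common selection \<open>j\<close> visit the union of its shells at most
  \<open>p / m * card K\<close> times, so \<open>card_separated_bound\<close> applies with
  \<open>\<beta> = p / m\<close>.\<close>

lemma (in Metric_space) separated_entropy_bound:
  fixes z :: "nat \<Rightarrow> 'a" and rad :: "nat \<Rightarrow> real" and S :: "(nat \<Rightarrow> nat) \<Rightarrow> 'g set" and p m :: nat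
  defines "J \<equiv> {..<p} \<rightarrow>\<^sub>E {..<m}"
    and "\<C> \<equiv> \<lambda>j. shell_cover z (\<lambda>i. rad (j i)) (\<lambda>i. rad (Suc (j i))) ` {..<p}"
  assumes act: "group_action G M \<phi>" and compact: "compact_space mtopology"
    and cont: "\<And>g. g \<in> carrier G \<Longrightarrow> continuous_map mtopology mtopology (\<phi> g)"
    and cover: "M \<subseteq> (\<Union>i<p. mball (z i) (rad 0))" and rad: "strict_mono rad" "rad m \<le> \<epsilon> / 2"
    and m: "0 < m"
    and K: "finite K" "K \<noteq> {}" "K \<subseteq> carrier G"
    and A: "finite A" "A \<subseteq> M" "A \<noteq> {}"
    and sep: "\<And>x y. x \<in> A \<Longrightarrow> y \<in> A \<Longrightarrow> x \<noteq> y \<Longrightarrow> \<exists>h\<in>K. \<epsilon> \<le> d (\<phi> h x) (\<phi> h y)"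
    and S: "\<And>j. j \<in> J \<Longrightarrow> finite (S j) \<and> S j \<noteq> {} \<and> S j \<subseteq> carrier G"
    and t: "0 < t" "t \<le> 1"
  shows "\<exists>j\<in>J. ln (card A) \<le> p * ln m + card K * (ln (1 + t) + p / m * ln (p / t))
    + card (\<Union>f\<in>S j. (\<lambda>h. inv\<^bsub>G\<^esub> f \<otimes>\<^bsub>G\<^esub> h) ` K) / card (S j) * H_top mtopology (dyn_join M \<phi> (\<C> j) (S j))"
proof -
  interpret group_action G M \<phi> by (rule act)
  have \<phi>: "\<phi> h x \<in> M" if "h \<in> K" "x \<in> M" for h x
    using that K(3) element_image[OF _ _ refl] by blast
  have "\<forall>x\<in>A. \<forall>i. \<exists>k<m. card {h \<in> K. rad k \<le> d (z i) (\<phi> h x) \<and> d (z i) (\<phi> h x) < rad (Suc k)} * m \<le> card K"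
  proof (intro ballI allI ex_light_fibre K(1) m)
    fix x i k l h
    assume *: "rad k \<le> d (z i) (\<phi> h x) \<and> d (z i) (\<phi> h x) < rad (Suc k)"
      "rad l \<le> d (z i) (\<phi> h x) \<and> d (z i) (\<phi> h x) < rad (Suc l)"
    then have "rad k < rad (Suc l)" "rad l < rad (Suc k)" by linarith+
    then show "k = l"
      by (simp add: strict_mono_less[OF rad(1)])
  qed
  then have light: "\<exists>k. k < m \<and>
      card {h \<in> K. rad k \<le> d (z i) (\<phi> h x) \<and> d (z i) (\<phi> h x) < rad (Suc k)} * m \<le> card K"
    if "x \<in> A" for x i
    using that by blast
  define k where "k x i = (SOME k. k < m \<and>
      card {h \<in> K. rad k \<le> d (z i) (\<phi> h x) \<and> d (z i) (\<phi> h x) < rad (Suc k)} * m \<le> card K)" for x i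
  have k: "\<And>x i. x \<in> A \<Longrightarrow> k x i < m" "\<And>x i. x \<in> A \<Longrightarrow>
      card {h \<in> K. rad (k x i) \<le> d (z i) (\<phi> h x) \<and> d (z i) (\<phi> h x) < rad (Suc (k x i))} * m \<le> card K"
    unfolding k_def using someI_ex[OF light] by simp_all
  define key where "key x = (\<lambda>i\<in>{..<p}. k x i)" for x
  have key: "key x \<in> J" if "x \<in> A" for x
    using k(1)[OF that] by (simp add: key_def J_def restrict_PiE_iff)
  have J: "finite J" "card J = m ^ p"
    by (simp_all add: J_def finite_PiE card_PiE)
  have "J \<noteq> {}" using key A(3) by blast
  then obtain j where j: "j \<in> J" "card A \<le> card (key -` {j} \<inter> A) * card J"
    using pigeonhole_card[of key A J] key A(1) J(1) by (metis Pi_I)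
  define A' where "A' = key -` {j} \<inter> A"
  define r where "r = (\<lambda>i. rad (j i))"
  define s where "s = (\<lambda>i. rad (Suc (j i)))"
  define B where "B = {x \<in> M. \<exists>i<p. r i \<le> d (z i) x \<and> d (z i) x < s i}"
  have C: "\<C> j = shell_cover z r s ` {..<p}"
    unfolding \<C>_def r_def s_def ..
  have rs: "r i < s i" for i
    by (simp add: r_def s_def strict_mono_less[OF rad(1)])
  have cover_r: "M \<subseteq> (\<Union>i<p. mball (z i) (r i))"
  proof -
    have "rad 0 \<le> r i" for i
      by (simp add: r_def strict_mono_less_eq[OF rad(1)])
    then have "mball (z i) (rad 0) \<subseteq> mball (z i) (r i)" for i
      by (rule mball_subset_concentric)
    then show ?thesis using cover by blast
  qed
  have "0 < p" using cover A(2,3) by (cases p) auto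
  have open_C: "open_cover mtopology (\<C> j)"
    unfolding C by (rule open_cover_shell_cover[OF cover_r rs])
  have Sj: "finite (S j)" "S j \<noteq> {}" "S j \<subseteq> carrier G"
    using S[OF j(1)] by auto
  have "open_cover mtopology (dyn_join M \<phi> (\<C> j) (S j))"
    using cont by (intro open_cover_dyn_join open_C Sj) simp_all
  then obtain \<W> where \<W>: "\<W> \<subseteq> dyn_join M \<phi> (\<C> j) (S j)" "finite \<W>" "\<Union>\<W> = topspace mtopology"
      "card \<W> = cover_number mtopology (dyn_join M \<phi> (\<C> j) (S j))"
    using cover_number_witness[OF compact] by metis
  have "\<W> \<noteq> {}" using \<W>(3) A(2,3) by auto
  then have "0 < card \<W>" using \<W>(2) by (simp add: card_gt_0_iff)
  let ?T = "\<Union>f\<in>S j. (\<lambda>h. inv\<^bsub>G\<^esub> f \<otimes>\<^bsub>G\<^esub> h) ` K"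
  have "real (card A') \<le> ((1 + t) * (card {..<p} / t) powr (p / m)) ^ card K
      * card \<W> powr (card ?T / card (S j))"
  proof (rule card_separated_bound[OF Sj K(1,3) \<W>(2), where V = "shell_cover z r s" and B = B and code = "ball_code z r"])
    show "\<Union>\<W> = M" using \<W>(3) by simp
    show "\<exists>i\<in>{..<p}. \<forall>x\<in>W. \<phi> f x \<in> shell_cover z r s i" if W: "W \<in> \<W>" "f \<in> S j" for W f
    proof -
      obtain U where "U \<in> \<C> j" "\<And>x. x \<in> W \<Longrightarrow> \<phi> f x \<in> U"
        using dyn_join_memD[OF subsetD[OF \<W>(1) W(1)] W(2)] by metis
      then show ?thesis unfolding C by blast
    qed
    show "{..<p} \<noteq> {}" using \<open>0 < p\<close> by blast
    show "ball_code z r x \<in> {..<p}" if "x \<in> M" for x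
      using ball_code(1)[OF cover_r that] by simp
    show "ball_code z r x = i" if "x \<in> M - B" "i \<in> {..<p}" "x \<in> shell_cover z r s i" for x i
      using that by (intro ball_code_eq[where p = p and s = s]) (auto simp: B_def)
    show "A' \<subseteq> M" "finite A'" using A by (auto simp: A'_def)
    show "inj_on (\<lambda>x. \<lambda>h\<in>K. ball_code z r (\<phi> h x)) A'"
    proof (rule inj_onI, rule ccontr)
      fix x y assume xy: "x \<in> A'" "y \<in> A'" "x \<noteq> y"
        "(\<lambda>h\<in>K. ball_code z r (\<phi> h x)) = (\<lambda>h\<in>K. ball_code z r (\<phi> h y))"
      then obtain h where h: "h \<in> K" "\<epsilon> \<le> d (\<phi> h x) (\<phi> h y)"
        using sep by (auto simp: A'_def)
      define i where "i = ball_code z r (\<phi> h x)"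
      have M: "\<phi> h x \<in> M" "\<phi> h y \<in> M"
        using xy(1,2) A(2) \<phi>[OF h(1)] by (auto simp: A'_def)
      have "ball_code z r (\<phi> h y) = i"
        using fun_cong[OF xy(4), of h] h(1) by (simp add: i_def)
      then have i: "i < p" "z i \<in> M" "d (z i) (\<phi> h x) < r i" "d (z i) (\<phi> h y) < r i"
        using ball_code[OF cover_r M(1)] ball_code(2)[OF cover_r M(2)] by (simp_all add: i_def)
      \<comment> \<open>All inner radii lie below \<open>rad m\<close>, hence below
        \<open>\<epsilon> / 2\<close>. Two orbit points with the same code share a ball of such a
        radius and are less than \<open>\<epsilon>\<close> apart.\<close>
      have "j i < m" using j(1) i(1) by (auto simp: J_def)
      then have "r i \<le> \<epsilon> / 2"
        using rad(2) strict_mono_less[OF rad(1), of "j i" m] by (simp add: r_def)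
      moreover have "d (\<phi> h x) (\<phi> h y) \<le> d (z i) (\<phi> h x) + d (z i) (\<phi> h y)"
        using triangle[OF M(1) i(2) M(2)] by (simp add: commute)
      ultimately show False
        using h(2) i(3,4) by linarith
    qed
    show "real (card {h \<in> K. \<phi> h x \<in> B}) \<le> p / m * card K" if x: "x \<in> A'" for x
    proof -
      have xA: "x \<in> A" and kj: "\<And>i. i < p \<Longrightarrow> k x i = j i"
        using x unfolding A'_def key_def by (auto dest: fun_cong)
      let ?N = "\<lambda>i. {h \<in> K. r i \<le> d (z i) (\<phi> h x) \<and> d (z i) (\<phi> h x) < s i}"
      have "{h \<in> K. \<phi> h x \<in> B} \<subseteq> (\<Union>i<p. ?N i)"
        by (auto simp: B_def)
      then have "card {h \<in> K. \<phi> h x \<in> B} \<le> card (\<Union>i<p. ?N i)"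
        using K(1) by (intro card_mono) auto
      also have "\<dots> \<le> (\<Sum>i<p. card (?N i))"
        by (rule card_UN_le) simp
      finally have "real (card {h \<in> K. \<phi> h x \<in> B}) \<le> real (\<Sum>i<p. card (?N i))"
        by (rule of_nat_mono)
      also have "\<dots> = (\<Sum>i<p. real (card (?N i)))"
        by (rule of_nat_sum)
      also have "\<dots> \<le> (\<Sum>i<p. card K / m)"
      proof (rule sum_mono)
        fix i assume "i \<in> {..<p}"
        then have "card (?N i) * m \<le> card K"
          using k(2)[OF xA, of i] kj[of i] by (simp add: r_def s_def)
        then have "real (card (?N i) * m) \<le> real (card K)"
          by (rule of_nat_mono)
        then show "real (card (?N i)) \<le> card K / m"
          using m by (simp add: pos_le_divide_eq)
      qed
      finally show ?thesis by simp
    qed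
  qed (use t in simp_all)
  then have A': "real (card A') \<le> ((1 + t) * (p / t) powr (p / m)) ^ card K
      * card \<W> powr (card ?T / card (S j))"
    by simp
  have "real (card A) \<le> real (m ^ p) * real (card A')"
    using j(2) unfolding J(2) A'_def by (metis mult.commute of_nat_le_iff of_nat_mult)
  also have "\<dots> \<le> real m ^ p * (((1 + t) * (p / t) powr (p / m)) ^ card K
      * card \<W> powr (card ?T / card (S j)))"
    using A' by (simp add: mult_left_mono)
  finally have "ln (card A) \<le> ln (real m ^ p * (((1 + t) * (p / t) powr (p / m)) ^ card K
      * card \<W> powr (card ?T / card (S j))))"
    using A(1,3) by (intro ln_mono) (simp_all add: card_gt_0_iff)
  also have "\<dots> = p * ln m + card K * (ln (1 + t) + p / m * ln (p / t))
      + card ?T / card (S j) * ln (card \<W>)"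
    using m t \<open>0 < p\<close> \<open>0 < card \<W>\<close> by (simp add: ln_mult ln_realpow ln_powr)
  finally show ?thesis
    using j(1) unfolding H_top_def \<W>(4) by blast
qed

text \<open>A gap between the two entropies is contradicted by a budget of three errors
  \<open>\<delta>\<close> per element of \<open>K\<close>: one for the choice of radii, one for the
  visits to the shells, one for the excess of the translates.\<close>

lemma (in Metric_space) h_top_cover_le_infinite_group:
  assumes act: "group_action G M \<phi>" and compact: "compact_space mtopology" and ne: "M \<noteq> {}"
    and cont: "\<And>g. g \<in> carrier G \<Longrightarrow> continuous_map mtopology mtopology (\<phi> g)"
    and \<U>: "open_cover mtopology \<U>" and F: "folner_sequence G F" and inf: "infinite (carrier G)"
  shows "h_top_cover mtopology \<phi> F \<U> \<le> h_top_star mtopology G \<phi>"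
proof (rule ccontr)
  interpret group_action G M \<phi> by (rule act)
  interpret group G
    using group_hom group_hom.axioms(1) by auto
  assume "\<not> ?thesis"
  then have lt: "h_top_star mtopology G \<phi> < h_top_cover mtopology \<phi> F \<U>"
    by (simp add: not_le)
  obtain b where b: "h_top_star mtopology G \<phi> < ereal b" "ereal b < h_top_cover mtopology \<phi> F \<U>"
    using ereal_dense2[OF lt] by blast
  obtain a where a: "h_top_star mtopology G \<phi> < ereal a" "a < b"
    using ereal_dense2[OF b(1)] by auto
  define \<delta> where "\<delta> = (b - a) / 4"
  have \<delta>: "0 < \<delta>" "b = a + 4 * \<delta>" using a(2) by (simp_all add: \<delta>_def field_simps)

  obtain \<epsilon> where \<epsilon>: "0 < \<epsilon>" "\<And>x. x \<in> M \<Longrightarrow> \<exists>U\<in>\<U>. mball x \<epsilon> \<subseteq> U"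
    using ex_Lebesgue_number[OF compact \<U>] by metis
  have tb: "mtotally_bounded M"
    using compact compact_space_eq_mcomplete_mtotally_bounded by blast
  have "0 < \<epsilon> / 4" using \<epsilon>(1) by simp
  then obtain Z where Z: "finite Z" "M \<subseteq> (\<Union>x\<in>Z. mball x (\<epsilon> / 4))"
    using tb unfolding mtotally_bounded_def by meson
  define p where "p = card Z"
  obtain z where z: "bij_betw z {0..<p} Z"
    using ex_bij_betw_nat_finite[OF Z(1)] unfolding p_def by blast
  have cover: "M \<subseteq> (\<Union>i<p. mball (z i) (\<epsilon> / 4))"
  proof -
    have "Z = z ` {..<p}"
      using z by (simp add: bij_betw_def atLeast0LessThan)
    then show ?thesis using Z(2) by simp
  qed
  have "0 < p" using cover ne by (cases p) auto

  \<comment> \<open>First \<open>t\<close> makes \<open>ln (1 + t)\<close> at most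
    \<open>\<delta> / 2\<close>; then \<open>m\<close> is taken so large that the remaining entropy
    of the visits is at most \<open>\<delta> / 2\<close>.\<close>
  define t where "t = min 1 (\<delta> / 2)"
  have t: "0 < t" "t \<le> 1" using \<delta>(1) by (simp_all add: t_def)
  have ln_t: "ln (1 + t) \<le> \<delta> / 2"
    using ln_add_one_self_le_self[of t] t(1) by (simp add: t_def)
  have pt: "0 \<le> ln (p / t)"
    using t \<open>0 < p\<close> by (simp add: field_simps)
  obtain m :: nat where m': "2 * p * ln (p / t) / \<delta> < m"
    using reals_Archimedean2 by blast
  have "0 \<le> 2 * p * ln (p / t) / \<delta>"
    using pt \<delta>(1) by simp
  with m' have m: "0 < m"
    by linarith
  have pm: "p / m * ln (p / t) \<le> \<delta> / 2"
    using m' m \<delta>(1) by (simp add: field_simps)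
  \<comment> \<open>Equally spaced radii from \<open>\<epsilon> / 4\<close> to
    \<open>\<epsilon> / 2\<close>, bounding \<open>m\<close> disjoint shells around each
    centre.\<close>
  define rad where "rad k = \<epsilon> / 4 + k * (\<epsilon> / (4 * m))" for k :: nat
  have rad: "strict_mono rad" "rad m \<le> \<epsilon> / 2" "rad 0 = \<epsilon> / 4"
    using \<epsilon>(1) m by (simp_all add: rad_def strict_mono_def divide_strict_right_mono)

  define J where "J = {..<p} \<rightarrow>\<^sub>E {..<m}"
  define \<C> where "\<C> j = shell_cover z (\<lambda>i. rad (j i)) (\<lambda>i. rad (Suc (j i))) ` {..<p}" for j
  have J: "finite J" "J \<noteq> {}"
    using m by (simp_all add: J_def finite_PiE PiE_eq_empty_iff lessThan_empty_iff)
  have open_C: "open_cover mtopology (\<C> j)" for j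
    unfolding \<C>_def
  proof (rule open_cover_shell_cover)
    show "rad (j i) < rad (Suc (j i))" for i
      by (simp add: strict_mono_less[OF rad(1)])
    have "\<epsilon> / 4 \<le> rad (j i)" for i
      using \<epsilon>(1) by (simp add: rad_def)
    then have "mball (z i) (\<epsilon> / 4) \<subseteq> mball (z i) (rad (j i))" for i
      by (rule mball_subset_concentric)
    then show "M \<subseteq> (\<Union>i<p. mball (z i) (rad (j i)))"
      using cover by blast
  qed
  \<comment> \<open>The covers \<open>\<C> j\<close> depend only on the radii, so the sets
    \<open>S j\<close> are fixed before \<open>n\<close>; finiteness of \<open>J\<close> then lets
    one \<open>n\<close> serve all of them.\<close>
  have "\<exists>S. S \<noteq> {} \<and> finite S \<and> S \<subseteq> carrier G \<and>
      1 / real (card S) * H_top mtopology (dyn_join M \<phi> (\<C> j) S) < a" for j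
  proof -
    have "h_top_star_cover mtopology G \<phi> (\<C> j) \<le> h_top_star mtopology G \<phi>"
      unfolding h_top_star_def using open_C by (intro SUP_upper) simp
    then have "h_top_star_cover mtopology G \<phi> (\<C> j) < ereal a"
      using a(1) by (rule le_less_trans)
    then show ?thesis
      unfolding h_top_star_cover_def INF_less_iff by auto
  qed
  then obtain S where S: "\<And>j. S j \<noteq> {}" "\<And>j. finite (S j)" "\<And>j. S j \<subseteq> carrier G"
      "\<And>j. 1 / real (card (S j)) * H_top mtopology (dyn_join M \<phi> (\<C> j) (S j)) < a"
    by metis
  \<comment> \<open>This holds for every \<open>\<V>\<close>, because \<open>ln 0 = 0\<close> when
    \<open>cover_number\<close> is 0.\<close>
  have H_nonneg: "0 \<le> H_top mtopology \<V>" for \<V>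
    by (cases "cover_number mtopology \<V>") (simp_all add: H_top_def)
  have "0 < a"
    using S(4)[of undefined] H_nonneg by (smt (verit) divide_nonneg_nonneg mult_nonneg_nonneg of_nat_0_le_iff)

  define v where "v n = 1 / real (card (F n)) * H_top mtopology (dyn_join M \<phi> \<U> (F n))" for n
  \<comment> \<open>The limit superior gives \<open>b < v n\<close> only for infinitely many
    \<open>n\<close>; the Folner estimates hold eventually, so some \<open>n\<close> satisfies
    everything.\<close>
  have freq: "\<exists>\<^sub>F n in sequentially. b < v n"
  proof (rule ccontr)
    assume "\<not> ?thesis"
    then have "\<forall>\<^sub>F n in sequentially. ereal (v n) \<le> ereal b"
      by (simp add: not_frequently not_less)
    then have "h_top_cover mtopology \<phi> F \<U> \<le> ereal b"
      unfolding h_top_cover_def v_def by (intro Limsup_bounded) simp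
    with b(2) show False by simp
  qed
  \<comment> \<open>The factor \<open>1 + \<delta> / a\<close> is chosen so that multiplication by
    \<open>a\<close> gives \<open>a + \<delta>\<close>.\<close>
  have ev1: "\<forall>\<^sub>F n in sequentially. \<forall>j\<in>J.
      card (\<Union>f\<in>S j. (\<lambda>h. inv\<^bsub>G\<^esub> f \<otimes>\<^bsub>G\<^esub> h) ` F n) \<le> (1 + \<delta> / a) * card (F n)"
    using \<delta>(1) \<open>0 < a\<close> by (intro eventually_ball_finite J ballI folner_card_translates F S) simp
  \<comment> \<open>Here infinitude of the group enters: the fixed cost \<open>p * ln m\<close> is
    absorbed by \<open>\<delta> * card (F n)\<close>.\<close>
  have ev2: "\<forall>\<^sub>F n in sequentially. nat \<lceil>p * ln m / \<delta>\<rceil> \<le> card (F n)"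
    by (rule folner_card_unbounded[OF F inf])
  obtain n where n: "b < v n"
      "\<forall>j\<in>J. card (\<Union>f\<in>S j. (\<lambda>h. inv\<^bsub>G\<^esub> f \<otimes>\<^bsub>G\<^esub> h) ` F n) \<le> (1 + \<delta> / a) * card (F n)"
      "nat \<lceil>p * ln m / \<delta>\<rceil> \<le> card (F n)"
    using frequently_ex[OF frequently_eventually_conj[OF freq eventually_conj[OF ev1 ev2]]]
    by (elim exE conjE) (rule that)
  define K where "K = F n"
  have K: "finite K" "K \<noteq> {}" "K \<subseteq> carrier G"
    using F by (auto simp: folner_sequence_def K_def)
  then have "0 < card K" by (simp add: card_gt_0_iff)
  have \<phi>: "\<phi> h x \<in> M" if "h \<in> K" "x \<in> M" for h x
    using that K(3) element_image[OF _ _ refl] by blast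
  obtain A where A: "finite A" "A \<subseteq> M"
    "\<And>x y. x \<in> A \<Longrightarrow> y \<in> A \<Longrightarrow> x \<noteq> y \<Longrightarrow> \<exists>h\<in>K. \<epsilon> \<le> d (\<phi> h x) (\<phi> h y)"
    "\<And>x. x \<in> M \<Longrightarrow> \<exists>y\<in>A. \<forall>h\<in>K. d (\<phi> h y) (\<phi> h x) < \<epsilon>"
  proof (rule ex_maximal_separated[where \<phi> = \<phi>, OF tb \<epsilon>(1) K(1)])
    show "\<phi> h x \<in> M" if "h \<in> K" "x \<in> M" for h x
      using that by (rule \<phi>)
  qed (rule that)
  have "A \<noteq> {}" using A(4) ne by blast
  have N_le: "cover_number mtopology (dyn_join M \<phi> \<U> K) \<le> card A"
    by (rule cover_number_dyn_join_le_spanning[where \<phi> = \<phi>, OF \<epsilon>(2) K(2) \<phi> A(1,2,4)])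
  have cover0: "M \<subseteq> (\<Union>i<p. mball (z i) (rad 0))"
    unfolding rad(3) by (rule cover)
  have "\<exists>j\<in>J. ln (card A) \<le> p * ln m
      + card K * (ln (1 + t) + p / m * ln (p / t))
      + card (\<Union>f\<in>S j. (\<lambda>h. inv\<^bsub>G\<^esub> f \<otimes>\<^bsub>G\<^esub> h) ` K) / card (S j)
        * H_top mtopology (dyn_join M \<phi> (\<C> j) (S j))"
    unfolding J_def \<C>_def
    by (rule separated_entropy_bound[OF act compact cont cover0 rad(1,2) m K A(1,2) \<open>A \<noteq> {}\<close> A(3) _ t])
      (simp_all add: S)
  then obtain j where j: "j \<in> J" and A_le: "ln (card A) \<le> p * ln m
      + card K * (ln (1 + t) + p / m * ln (p / t))
      + card (\<Union>f\<in>S j. (\<lambda>h. inv\<^bsub>G\<^esub> f \<otimes>\<^bsub>G\<^esub> h) ` K) / card (S j)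
        * H_top mtopology (dyn_join M \<phi> (\<C> j) (S j))"
    by (elim bexE) (rule that)
  let ?H = "1 / real (card (S j)) * H_top mtopology (dyn_join M \<phi> (\<C> j) (S j))"
  have 1: "b * card K < H_top mtopology (dyn_join M \<phi> \<U> K)"
    using n(1) \<open>0 < card K\<close> by (simp add: v_def K_def pos_less_divide_eq)
  have 2: "H_top mtopology (dyn_join M \<phi> \<U> K) \<le> ln (card A)"
  proof -
    have "open_cover mtopology (dyn_join M \<phi> \<U> K)"
      using cont by (intro open_cover_dyn_join \<U> K) simp_all
    then have "0 < cover_number mtopology (dyn_join M \<phi> \<U> K)"
      using compact ne by (intro cover_number_pos) simp_all
    then show ?thesis
      using N_le unfolding H_top_def by (intro ln_mono) simp_all
  qed
  have 3: "p * ln m \<le> \<delta> * card K"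
  proof -
    have "p * ln m / \<delta> \<le> card K"
      using n(3) unfolding K_def by linarith
    then show ?thesis
      using \<delta>(1) by (simp add: pos_divide_le_eq mult.commute)
  qed
  have 4: "card K * (ln (1 + t) + p / m * ln (p / t)) \<le> card K * \<delta>"
  proof (rule mult_left_mono)
    show "ln (1 + t) + p / m * ln (p / t) \<le> \<delta>"
      using ln_t pm by linarith
  qed simp
  have "card (\<Union>f\<in>S j. (\<lambda>h. inv\<^bsub>G\<^esub> f \<otimes>\<^bsub>G\<^esub> h) ` K) / card (S j)
      * H_top mtopology (dyn_join M \<phi> (\<C> j) (S j))
      = card (\<Union>f\<in>S j. (\<lambda>h. inv\<^bsub>G\<^esub> f \<otimes>\<^bsub>G\<^esub> h) ` K) * ?H"
    by simp
  also have "\<dots> \<le> ((1 + \<delta> / a) * card K) * a"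
    using n(2) j S(4)[of j] H_nonneg \<delta>(1) \<open>0 < a\<close> unfolding K_def
    by (intro mult_mono) (simp_all add: less_imp_le)
  also have "\<dots> = (a + \<delta>) * card K"
    using \<open>0 < a\<close> by (simp add: field_simps)
  finally have "b * card K < \<delta> * card K + card K * \<delta> + (a + \<delta>) * card K"
    using 1 2 3 4 A_le by linarith
  also have "\<dots> = (a + 3 * \<delta>) * card K"
    by (simp add: algebra_simps)
  also have "\<dots> \<le> b * card K"
    using \<delta> by (intro mult_right_mono) simp_all
  finally show False by simp
qed

text \<open>Each \<open>F n\<close> competes in the infimum, which therefore lies below even the
  limit inferior.\<close>

lemma h_top_star_cover_le_h_top_cover:
  assumes "folner_sequence G F"
  shows "h_top_star_cover T G \<phi> \<U> \<le> h_top_cover T \<phi> F \<U>"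
proof -
  let ?v = "\<lambda>n. ereal (1 / real (card (F n)) * H_top T (dyn_join (topspace T) \<phi> \<U> (F n)))"
  have "h_top_star_cover T G \<phi> \<U> \<le> ?v n" for n
    unfolding h_top_star_cover_def using assms by (intro INF_lower) (simp add: folner_sequence_def)
  then have "h_top_star_cover T G \<phi> \<U> \<le> Liminf sequentially ?v"
    by (intro Liminf_bounded always_eventually allI)
  also have "\<dots> \<le> h_top_cover T \<phi> F \<U>"
    unfolding h_top_cover_def by (rule Liminf_le_Limsup) simp
  finally show ?thesis .
qed

theorem theorem6p8:
  fixes X :: "'a set" and d :: "'a \<Rightarrow> 'a \<Rightarrow> real"
    and G :: "('g, 'm) monoid_scheme" and \<phi> :: "'g \<Rightarrow> 'a \<Rightarrow> 'a"
    and F :: "nat \<Rightarrow> 'g set"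
  assumes metric: "Metric_space X d"
    and compact: "compact_space (Metric_space.mtopology X d)"
    and nonempty: "X \<noteq> {}"
    and group: "group G"
    and countable: "countable (carrier G)"
    and amenable: "amenable G"
    and action: "group_action G X \<phi>"
    and continuous: "\<And>g. g \<in> carrier G \<Longrightarrow>
      continuous_map (Metric_space.mtopology X d) (Metric_space.mtopology X d) (\<phi> g)"
    and folner: "folner_sequence G F"
  shows "h_top_star (Metric_space.mtopology X d) G \<phi> = h_top (Metric_space.mtopology X d) \<phi> F"
proof (rule antisym)
  interpret Metric_space X d by (rule metric)
  show "h_top_star mtopology G \<phi> \<le> h_top mtopology \<phi> F"
    unfolding h_top_star_def h_top_def
    by (intro SUP_mono' h_top_star_cover_le_h_top_cover folner)
  show "h_top mtopology \<phi> F \<le> h_top_star mtopology G \<phi>"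
    unfolding h_top_def
  proof (rule SUP_least)
    fix \<U> assume "\<U> \<in> {\<U>. open_cover mtopology \<U>}"
    then have \<U>: "open_cover mtopology \<U>" by simp
    show "h_top_cover mtopology \<phi> F \<U> \<le> h_top_star mtopology G \<phi>"
    proof (cases "finite (carrier G)")
      case True
      show ?thesis
        by (rule group_action.h_top_cover_le_finite_group
            [OF action compact topspace_mtopology nonempty continuous \<U> folner True])
    next
      case False
      show ?thesis
        by (rule h_top_cover_le_infinite_group
            [OF action compact nonempty continuous \<U> folner False])
    qed
  qed
qed

end
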